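(* For every $n\ge1$, $1\le k\le n$ and $\epsilon>0$, there is a quantum algorithm that $\epsilon$-tests the set $k\text{-Juntas}\subseteq\mathbb{U}_N$ using $O(k\log(k/\epsilon)/\epsilon^2)$ queries to $U$, where the implied constant is independent of $n$, $k$, $\epsilon$.
   Context: Let $n\ge1$, $N=2^n$, $\mathbb{U}_d$ the $d\times d$ unitaries, and $[n]=\{1,\dots,n\}$ indexing the qubits of $(\mathbb{C}^2)^{\otimes n}$. For $T\subseteq[n]$ and $V\in\mathbb{U}_{2^{|T|}}$, $V_T\otimes I_{T^c}$ is the operator acting as $V$ on the qubits in $T$ and as the identity on the others. $k\text{-Juntas}=\{U\in\mathbb{U}_N:\exists T\subseteq[n], |T|=k, \exists V\in\mathbb{U}_{2^k}, U=V_T\otimes I_{T^c}\}$. $\|A\|=\sqrt{\mathrm{tr}(A^\dagger A)}$; $D(A,B)=\min_{\theta\in[0,2\pi)}\frac{1}{\sqrt{2N}}\|e^{i\theta}A-B\|$; $D(A,\mathcal{S})=\inf_{B\in\mathcal{S}}D(A,B)$. For $\mathcal{S}\subseteq\mathbb{U}_N$, $U$ has property $\mathcal{S}$ if $U=e^{i\theta}V$ for some $V\in\mathcal{S}$, real $\theta$; $U$ is $\epsilon$-far from $\mathcal{S}$ if $D(U,V)\ge\epsilon$ for all $V\in\mathcal{S}$. Testing model: the unknown $U\in\mathbb{U}_N$ is a black box; the algorithm may prepare arbitrary states on the system plus an ancilla, apply $U\otimes I$ (one query each), interleaved with arbitrary fixed quantum operations, and measure. It $\epsilon$-tests $\mathcal{S}$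 if for every $U\in\mathbb{U}_N$ it accepts with probability $\ge2/3$ when $U$ has property $\mathcal{S}$ and with probability $\le1/3$ when $U$ is $\epsilon$-far from $\mathcal{S}$.
   Formalization: The query bound is stated as C·k·max(1, ln(k/ε))/ε², since log(k/ε) is zero or negative when ε ≥ k; for k = 1, ε = 1 the literal bound would allow no queries, although X⊗X is 1-far from the 1-juntas and must be told apart from the identity. *)

theory Defs
  imports "HOL-Analysis.Analysis" "Jordan_Normal_Form.Matrix"
begin

(* Complex matrices/vectors from Jordan_Normal_Form.Matrix. Basis states of n qubits are
   indexed by x < 2^n; qubit j (0-based, j < n) of x is bit j of x. *)

definition adj :: "complex mat \<Rightarrow> complex mat" where
  "adj A = mat (dim_col A) (dim_row A) (\<lambda>(i,j). cnj (A $$ (j,i)))"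

definition unitary_mat :: "nat \<Rightarrow> complex mat \<Rightarrow> bool" where
  "unitary_mat d U \<longleftrightarrow> U \<in> carrier_mat d d \<and> adj U * U = 1\<^sub>m d"

definition hs_norm :: "complex mat \<Rightarrow> real" where
  "hs_norm A = sqrt (\<Sum>i<dim_row A. \<Sum>j<dim_col A. (cmod (A $$ (i,j)))\<^sup>2)"

definition dist_ph :: "nat \<Rightarrow> complex mat \<Rightarrow> complex mat \<Rightarrow> real" where
  "dist_ph N A B = Inf ((\<lambda>\<theta>. hs_norm (exp (\<i> * complex_of_real \<theta>) \<cdot>\<^sub>m A - B) / sqrt (2 * real N))
                        ` {0..<2*pi})"

definition qbit :: "nat \<Rightarrow> nat \<Rightarrow> bool" where
  "qbit x j \<longleftrightarrow> odd (x div 2 ^ j)"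

(* index of the restriction of basis state x to the qubits in T (listed increasingly) *)
definition sub_index :: "nat set \<Rightarrow> nat \<Rightarrow> nat" where
  "sub_index T x = (\<Sum>i<card T. if qbit x (sorted_list_of_set T ! i) then 2 ^ i else 0)"

(* V_T \<otimes> I_{T^c} on n qubits *)
definition embed_op :: "nat \<Rightarrow> nat set \<Rightarrow> complex mat \<Rightarrow> complex mat" where
  "embed_op n T V = mat (2^n) (2^n) (\<lambda>(x,y).
      if (\<forall>j<n. j \<notin> T \<longrightarrow> qbit x j = qbit y j) then V $$ (sub_index T x, sub_index T y) else 0)"

definition juntas :: "nat \<Rightarrow> nat \<Rightarrow> complex mat set" where
  "juntas n k = {U. \<exists>T. T \<subseteq> {..<n} \<and> card T = k \<and>
                    (\<exists>V. unitary_mat (2^k) V \<and> U = embed_op n T V)}"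

definition has_property :: "complex mat set \<Rightarrow> complex mat \<Rightarrow> bool" where
  "has_property S U \<longleftrightarrow> (\<exists>\<theta>::real. \<exists>V\<in>S. U = exp (\<i> * complex_of_real \<theta>) \<cdot>\<^sub>m V)"

definition eps_far :: "nat \<Rightarrow> complex mat set \<Rightarrow> real \<Rightarrow> complex mat \<Rightarrow> bool" where
  "eps_far N S \<epsilon> U \<longleftrightarrow> (\<forall>V\<in>S. dist_ph N U V \<ge> \<epsilon>)"

(* U \<otimes> I_d on system (first factor, dimension N) plus ancilla (dimension d):
   basis index of |x>|a> is x*d + a *)
definition kron_id :: "nat \<Rightarrow> complex mat \<Rightarrow> complex mat" where
  "kron_id d U = mat (dim_row U * d) (dim_col U * d)
      (\<lambda>(i,j). if i mod d = j mod d then U $$ (i div d, j div d) else 0)"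

definition vnorm_sq :: "complex vec \<Rightarrow> real" where
  "vnorm_sq v = (\<Sum>i<dim_vec v. (cmod (v $ i))\<^sup>2)"

(* A query algorithm: ancilla dimension, initial state on system+ancilla, the fixed
   operations W_1..W_q applied after each of the q queries U\<otimes>I, and the accepting projector. *)
record qalg =
  anc :: nat
  init :: "complex vec"
  ops :: "complex mat list"
  acc :: "complex mat"

definition valid_qalg :: "nat \<Rightarrow> qalg \<Rightarrow> bool" where
  "valid_qalg N A \<longleftrightarrow> anc A \<ge> 1 \<and> init A \<in> carrier_vec (N * anc A) \<and> vnorm_sq (init A) = 1
     \<and> (\<forall>W\<in>set (ops A). unitary_mat (N * anc A) W)
     \<and> acc A \<in> carrier_mat (N * anc A) (N * anc A) \<and> acc A * acc A = acc A \<and> adj (acc A) = acc A"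

definition num_queries :: "qalg \<Rightarrow> nat" where
  "num_queries A = length (ops A)"

definition final_state :: "qalg \<Rightarrow> complex mat \<Rightarrow> complex vec" where
  "final_state A U = fold (\<lambda>W s. W *\<^sub>v (kron_id (anc A) U *\<^sub>v s)) (ops A) (init A)"

definition accept_prob :: "qalg \<Rightarrow> complex mat \<Rightarrow> real" where
  "accept_prob A U = vnorm_sq (acc A *\<^sub>v final_state A U)"

definition eps_tests :: "nat \<Rightarrow> qalg \<Rightarrow> complex mat set \<Rightarrow> real \<Rightarrow> bool" where
  "eps_tests N A S \<epsilon> \<longleftrightarrow> (\<forall>U. unitary_mat N U \<longrightarrow>
      (has_property S U \<longrightarrow> accept_prob A U \<ge> 2/3) \<and>
      (eps_far N S \<epsilon> U \<longrightarrow> accept_prob A U \<le> 1/3))"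

end

theory Submission
  imports Defs "Jordan_Normal_Form.Determinant" "HOL-Library.Nat_Bijection"
begin

text \<open>
  Apply \<open>U\<close> to one half of a maximally entangled state and measure in the basis of the Pauli
  operators \<open>X\<^sup>aZ\<^sup>b\<close>, indexed by sets \<open>a\<close>, \<open>b\<close> of qubits. The outcome \<open>(a, b)\<close> has probability equal to the
  squared modulus of the Pauli coefficient of \<open>U\<close>, and the operator acts on the qubits \<open>a \<union> b\<close>.
  Sample \<open>q = \<lceil>6k/\<epsilon>\<^sup>2\<rceil>\<close> times and accept if at most \<open>k\<close> qubits have been seen. Juntas are always accepted.

  For a set \<open>T\<close> of \<open>k\<close> qubits, the weight of the outcomes inside \<open>T\<close> is the normalized squared
  Hilbert-Schmidt norm of the normalized partial trace \<open>M\<close> of \<open>U\<close> over the complement of \<open>T\<close>.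
  As \<open>M\<close> is a contraction, its unitary polar factor \<open>V\<close> satisfies \<open>Re tr(V\<^sup>\<dagger>M) \<ge> tr(M\<^sup>\<dagger>M)\<close>,
  so that weight \<open>1 - \<delta>\<close> inside \<open>T\<close> yields a junta at distance at most \<open>\<surd>\<delta>\<close>. Hence, if \<open>U\<close> is
  \<open>\<epsilon>\<close>-far, then as long as at most \<open>k\<close> qubits have been seen every sample shows a new one with
  probability at least \<open>\<epsilon>\<^sup>2\<close>, and a potential that halves with every new qubit bounds the
  acceptance probability by \<open>2\<^sup>k (1 - \<epsilon>\<^sup>2/2)\<^sup>q\<close>. For \<open>\<epsilon> > 1\<close> no unitary is \<open>\<epsilon>\<close>-far and no query is needed.
\<close>

unbundle no vec_syntax

section \<open>Rounding a contraction to a unitary\<close>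

definition orthonormal_rows :: "'a set \<Rightarrow> ('a \<Rightarrow> 'a \<Rightarrow> complex) \<Rightarrow> bool" where
  "orthonormal_rows A V \<longleftrightarrow>
     (\<forall>i\<in>A. \<forall>l\<in>A. (\<Sum>j\<in>A. V i j * cnj (V l j)) = of_bool (i = l))"

lemma orthonormal_rows_entry_le_1:
  assumes "finite A" "orthonormal_rows A V" "i \<in> A" "j \<in> A"
  shows "cmod (V i j) \<le> 1"
proof -
  have "complex_of_real (\<Sum>j\<in>A. (cmod (V i j))\<^sup>2) = 1"
    using assms unfolding orthonormal_rows_def of_real_sum complex_norm_square by simp
  then have "(\<Sum>j\<in>A. (cmod (V i j))\<^sup>2) = 1"
    using of_real_eq_1_iff by blast
  moreover have "(cmod (V i j))\<^sup>2 \<le> (\<Sum>j\<in>A. (cmod (V i j))\<^sup>2)"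
    by (rule member_le_sum) (use assms in auto)
  ultimately have "(cmod (V i j))\<^sup>2 \<le> 1\<^sup>2"
    by simp
  then show ?thesis
    by (rule power2_le_imp_le) simp
qed

lemma continuous_on_apply: "continuous_on S (\<lambda>f::'b \<Rightarrow> complex. f p)"
  by (rule continuous_on_subset[OF continuous_on_product_coordinates subset_UNIV])

text \<open>Tychonoff. The index type is arbitrary, so compactness is taken in the product topology
  on all functions.\<close>

lemma compact_unit_polydisc: "compact {f::'b \<Rightarrow> complex. \<forall>p. f p \<in> cball 0 1}"
proof -
  have "compactin (product_topology (\<lambda>_. euclidean) UNIV) (PiE UNIV (\<lambda>_::'b. cball (0::complex) 1))"
    by (subst compactin_PiE) auto
  then have "compact (PiE UNIV (\<lambda>_::'b. cball (0::complex) 1))"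
    by (metis compactin_euclidean_iff euclidean_product_topology)
  moreover have "PiE UNIV (\<lambda>_::'b. cball (0::complex) 1) = {f. \<forall>p. f p \<in> cball 0 1}"
    by auto
  ultimately show ?thesis
    by simp
qed

text \<open>The functional is continuous, and the orthonormality equations cut a compact set out of
  the polydisc of entries of modulus at most 1.\<close>

lemma orthonormal_rows_maximizer:
  fixes M :: "'a \<Rightarrow> 'a \<Rightarrow> complex"
  assumes A: "finite A"
  shows "\<exists>V. orthonormal_rows A V \<and> (\<forall>W. orthonormal_rows A W \<longrightarrow>
     Re (\<Sum>i\<in>A. \<Sum>j\<in>A. cnj (W i j) * M i j) \<le> Re (\<Sum>i\<in>A. \<Sum>j\<in>A. cnj (V i j) * M i j))"
proof -
  define F where "F = (\<lambda>f::'a \<times> 'a \<Rightarrow> complex. Re (\<Sum>i\<in>A. \<Sum>j\<in>A. cnj (f (i,j)) * M i j))"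
  define K where "K = {f::'a \<times> 'a \<Rightarrow> complex. \<forall>p. f p \<in> cball 0 1} \<inter>
     (\<Inter>i\<in>A. \<Inter>l\<in>A. {f. (\<Sum>j\<in>A. f (i,j) * cnj (f (l,j))) = of_bool (i = l)})"
  have "compact K"
    unfolding K_def
    by (intro compact_Int_closed compact_unit_polydisc closed_INT ballI closed_Collect_eq
          continuous_intros continuous_on_apply)
  \<comment> \<open>\<open>orthonormal_rows A W\<close> does not control entries outside
    \<open>A\<close>; zeroing them puts \<open>W\<close> into the polydisc without changing any sum
    over \<open>A\<close>.\<close>
  define trunc where "trunc = (\<lambda>W::'a \<Rightarrow> 'a \<Rightarrow> complex. \<lambda>(i,j). if i \<in> A \<and> j \<in> A then W i j else 0)"
  have trunc: "trunc W \<in> K" if "orthonormal_rows A W" for W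
    using orthonormal_rows_entry_le_1[OF A that] that
    by (auto simp: K_def trunc_def orthonormal_rows_def)
  have "orthonormal_rows A (\<lambda>i j. of_bool (i = j))"
    unfolding orthonormal_rows_def by (auto simp: A of_bool_def if_distrib[where f="\<lambda>c. c * _"] cong: if_cong)
  then have "K \<noteq> {}"
    using trunc by blast
  moreover have "continuous_on K F"
    unfolding F_def by (intro continuous_intros continuous_on_apply)
  ultimately obtain f where f: "f \<in> K" "\<forall>g\<in>K. F g \<le> F f"
    using \<open>compact K\<close> continuous_attains_sup by blast
  have "orthonormal_rows A (curry f)"
    using f(1) by (auto simp: K_def orthonormal_rows_def)
  moreover have "Re (\<Sum>i\<in>A. \<Sum>j\<in>A. cnj (W i j) * M i j) \<le> Re (\<Sum>i\<in>A. \<Sum>j\<in>A. cnj (curry f i j) * M i j)"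
    if "orthonormal_rows A W" for W
  proof -
    have "F (trunc W) \<le> F f"
      using f trunc[OF that] by blast
    then show ?thesis
      by (simp add: F_def trunc_def)
  qed
  ultimately show ?thesis
    by blast
qed

section \<open>The polar factor as a maximizer\<close>

definition inner_on :: "'a set \<Rightarrow> ('a \<Rightarrow> complex) \<Rightarrow> ('a \<Rightarrow> complex) \<Rightarrow> complex" where
  "inner_on A x y = (\<Sum>j\<in>A. cnj (x j) * y j)"

definition app_on :: "'a set \<Rightarrow> ('a \<Rightarrow> 'a \<Rightarrow> complex) \<Rightarrow> ('a \<Rightarrow> complex) \<Rightarrow> 'a \<Rightarrow> complex" where
  "app_on A M x i = (\<Sum>j\<in>A. M i j * x j)"

lemma inner_on_self: "inner_on A x x = complex_of_real (\<Sum>j\<in>A. (cmod (x j))\<^sup>2)"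
  unfolding inner_on_def of_real_sum complex_norm_square by (simp add: mult.commute)

lemma inner_on_add_right: "inner_on A x (\<lambda>i. y i + z i) = inner_on A x y + inner_on A x z"
  and inner_on_add_left: "inner_on A (\<lambda>i. y i + z i) x = inner_on A y x + inner_on A z x"
  and inner_on_scale_right: "inner_on A x (\<lambda>i. c * y i) = c * inner_on A x y"
  and inner_on_scale_left: "inner_on A (\<lambda>i. c * y i) x = cnj c * inner_on A y x"
  unfolding inner_on_def
  by (simp_all add: algebra_simps sum.distrib sum_distrib_left)

lemma app_on_add: "app_on A M (\<lambda>i. y i + z i) = (\<lambda>i. app_on A M y i + app_on A M z i)"
  and app_on_scale: "app_on A M (\<lambda>i. c * y i) = (\<lambda>i. c * app_on A M y i)"
  unfolding app_on_def by (simp_all add: algebra_simps sum.distrib sum_distrib_left)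

text \<open>\<open>V\<close> is multiplied on the right by an operator that scales \<open>u\<close>
  by 1 + c|u|^2 and fixes the orthogonal complement of \<open>u\<close>. For nonzero
  \<open>u\<close> the condition on \<open>c\<close> says that this scalar has modulus 1.\<close>

lemma orthonormal_rows_perturb:
  fixes u :: "'a \<Rightarrow> complex"
  assumes A: "finite A" and V: "orthonormal_rows A V"
    and c: "c + cnj c + c * cnj c * inner_on A u u = 0"
  shows "orthonormal_rows A (\<lambda>i j. V i j + c * app_on A V u i * cnj (u j))"
  unfolding orthonormal_rows_def
proof (intro ballI)
  fix i l assume il: "i \<in> A" "l \<in> A"
  let ?a = "app_on A V u i" and ?b = "app_on A V u l"
  have "(\<Sum>j\<in>A. (V i j + c * ?a * cnj (u j)) * cnj (V l j + c * ?b * cnj (u j)))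
     = (\<Sum>j\<in>A. V i j * cnj (V l j)) + cnj c * cnj ?b * (\<Sum>j\<in>A. V i j * u j)
       + c * ?a * (\<Sum>j\<in>A. cnj (V l j) * cnj (u j)) + c * ?a * cnj c * cnj ?b * inner_on A u u"
    unfolding inner_on_def by (simp add: algebra_simps sum.distrib sum_distrib_left)
  also have "(\<Sum>j\<in>A. V i j * u j) = ?a"
    by (simp add: app_on_def)
  also have "(\<Sum>j\<in>A. cnj (V l j) * cnj (u j)) = cnj ?b"
    by (simp add: app_on_def)
  also have "(\<Sum>j\<in>A. V i j * cnj (V l j)) = of_bool (i = l)"
    using V il by (simp add: orthonormal_rows_def)
  also have "of_bool (i = l) + cnj c * cnj ?b * ?a + c * ?a * cnj ?b + c * ?a * cnj c * cnj ?b * inner_on A u u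
     = of_bool (i = l) + ?a * cnj ?b * (c + cnj c + c * cnj c * inner_on A u u)"
    by (simp add: algebra_simps)
  finally show "(\<Sum>j\<in>A. (V i j + c * ?a * cnj (u j)) * cnj (V l j + c * ?b * cnj (u j))) = of_bool (i = l)"
    using c by simp
qed

text \<open>The kernel on the left is the adjoint of \<open>V\<close> times \<open>M\<close>.
  Besides the polar decomposition, the case \<open>M = V\<close> serves to show that unitaries
  preserve inner products.\<close>

lemma inner_on_adjoint:
  "inner_on A x (app_on A (\<lambda>j l. \<Sum>i\<in>A. cnj (V i j) * M i l) y) = inner_on A (app_on A V x) (app_on A M y)"
proof -
  have "inner_on A x (app_on A (\<lambda>j l. \<Sum>i\<in>A. cnj (V i j) * M i l) y)
     = (\<Sum>j\<in>A. \<Sum>l\<in>A. \<Sum>i\<in>A. cnj (x j) * cnj (V i j) * (M i l * y l))"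
    unfolding inner_on_def app_on_def sum_distrib_left sum_distrib_right by (simp add: algebra_simps)
  also have "\<dots> = (\<Sum>j\<in>A. \<Sum>i\<in>A. \<Sum>l\<in>A. cnj (x j) * cnj (V i j) * (M i l * y l))"
    by (rule sum.cong[OF refl sum.swap])
  also have "\<dots> = (\<Sum>i\<in>A. \<Sum>j\<in>A. \<Sum>l\<in>A. cnj (x j) * cnj (V i j) * (M i l * y l))"
    by (rule sum.swap)
  also have "\<dots> = inner_on A (app_on A V x) (app_on A M y)"
    unfolding inner_on_def app_on_def cnj_sum sum_product by (simp add: algebra_simps)
  finally show ?thesis .
qed

lemma Re_inner_on_le:
  "Re (inner_on A x y) \<le> (Re (inner_on A x x) + Re (inner_on A y y)) / 2"
proof -
  have "2 * Re (cnj a * b) \<le> (cmod a)\<^sup>2 + (cmod b)\<^sup>2" for a b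
  proof -
    have "0 \<le> (Re a - Re b)\<^sup>2 + (Im a - Im b)\<^sup>2"
      by simp
    then show ?thesis
      by (simp add: cmod_power2 power2_diff)
  qed
  then have "(\<Sum>j\<in>A. 2 * Re (cnj (x j) * y j)) \<le> (\<Sum>j\<in>A. (cmod (x j))\<^sup>2 + (cmod (y j))\<^sup>2)"
    by (intro sum_mono)
  then have "2 * Re (inner_on A x y) \<le> Re (inner_on A x x) + Re (inner_on A y y)"
    unfolding inner_on_self by (simp add: inner_on_def sum.distrib sum_distrib_left)
  then show ?thesis
    by simp
qed

text \<open>A maximizer is the unitary factor of a polar decomposition: multiplying it by a rotation
  of the phase of a single vector cannot improve it, which forces the quadratic form of
  \<open>V\<^sup>\<dagger>M\<close> to be real and nonnegative.\<close>

lemma maximizer_form_nonneg: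
  fixes M :: "'a \<Rightarrow> 'a \<Rightarrow> complex"
  assumes A: "finite A" and V: "orthonormal_rows A V"
    and mx: "\<And>W. orthonormal_rows A W \<Longrightarrow>
     Re (\<Sum>i\<in>A. \<Sum>j\<in>A. cnj (W i j) * M i j) \<le> Re (\<Sum>i\<in>A. \<Sum>j\<in>A. cnj (V i j) * M i j)"
  defines "h \<equiv> \<lambda>u. inner_on A (app_on A V u) (app_on A M u)"
  shows "Im (h u) = 0" "0 \<le> Re (h u)"
proof -
  define s where "s = (\<Sum>j\<in>A. (cmod (u j))\<^sup>2)"
  have s: "inner_on A u u = of_real s"
    by (simp add: s_def inner_on_self)
  \<comment> \<open>The perturbation changes the objective by exactly \<open>cnj c * h u\<close>,
    whose real part cannot be positive at a maximizer.\<close>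
  have le: "Re (cnj c * h u) \<le> 0" if c: "c + cnj c + c * cnj c * inner_on A u u = 0" for c
  proof -
    have "(\<Sum>i\<in>A. \<Sum>j\<in>A. cnj (V i j + c * app_on A V u i * cnj (u j)) * M i j)
      = (\<Sum>i\<in>A. \<Sum>j\<in>A. cnj (V i j) * M i j)
       + (\<Sum>i\<in>A. \<Sum>j\<in>A. cnj c * (cnj (app_on A V u i) * (M i j * u j)))"
      by (simp add: algebra_simps sum.distrib)
    also have "(\<Sum>i\<in>A. \<Sum>j\<in>A. cnj c * (cnj (app_on A V u i) * (M i j * u j))) = cnj c * h u"
      unfolding h_def inner_on_def app_on_def[of A M] by (simp add: sum_distrib_left)
    finally show ?thesis
      using mx[OF orthonormal_rows_perturb[OF A V c]] by simp
  qed
  have "cmod (h u) \<le> Re (h u)"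
  proof (cases "s = 0 \<or> h u = 0")
    case True
    then show ?thesis
    proof
      assume "s = 0"
      then have "u j = 0" if "j \<in> A" for j
        using A that by (auto simp: s_def sum_nonneg_eq_0_iff)
      then have "h u = 0"
        by (simp add: h_def inner_on_def app_on_def)
      then show ?thesis
        by simp
    qed simp
  next
    case False
    then have s0: "s \<noteq> 0" and h0: "h u \<noteq> 0"
      by auto
    have "s > 0"
      using s0 unfolding s_def by (simp add: less_le sum_nonneg)
    \<comment> \<open>With 1 + c|u|^2 equal to the phase \<open>w\<close> of \<open>h u\<close>, the
      perturbation turns \<open>h u\<close> into its modulus, so the gain is proportional to
      \<open>cmod (h u) - Re (h u)\<close>.\<close>
    define w where "w = sgn (h u)"
    have w: "w * cnj w = 1"
      using h0 by (simp add: w_def flip: complex_norm_square) (simp add: norm_sgn)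
    have wh: "cnj w * h u = cmod (h u)"
    proof -
      have "h u = w * cmod (h u)"
        using h0 by (simp add: w_def sgn_eq)
      then show ?thesis
        using w by (metis mult.assoc mult.commute mult_1)
    qed
    define c where "c = (w - 1) / of_real s"
    have "c + cnj c + c * cnj c * of_real s = 0"
      using s0 w by (simp add: c_def field_simps)
    then have "Re (cnj c * h u) \<le> 0"
      using le s by simp
    moreover have "cnj c * h u = (cnj w * h u - h u) / of_real s"
      by (simp add: c_def algebra_simps diff_divide_distrib)
    ultimately have "(cmod (h u) - Re (h u)) / s \<le> 0"
      unfolding wh by simp
    then show ?thesis
      using \<open>s > 0\<close> by (simp add: divide_le_0_iff)
  qed
  then show re: "0 \<le> Re (h u)"
    using norm_ge_zero order_trans by blast
  have "(Re (h u))\<^sup>2 + (Im (h u))\<^sup>2 \<le> (Re (h u))\<^sup>2"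
    using \<open>cmod (h u) \<le> Re (h u)\<close> by (metis cmod_power2 norm_ge_zero power_mono)
  then show "Im (h u) = 0"
    by simp
qed

text \<open>For a maximizer \<open>V\<close> the product H of its adjoint with \<open>M\<close> is
  positive semidefinite, and |H z| = |M z| makes it a contraction. Hence H^2 \<le> H, and the trace
  of H^2 is the squared Hilbert-Schmidt norm of \<open>M\<close>.\<close>

lemma contraction_aligned_unitary:
  fixes M :: "'a \<Rightarrow> 'a \<Rightarrow> complex"
  assumes A: "finite A"
    and contr: "\<And>x. (\<Sum>i\<in>A. (cmod (app_on A M x i))\<^sup>2) \<le> (\<Sum>j\<in>A. (cmod (x j))\<^sup>2)"
  shows "\<exists>V. orthonormal_rows A V \<and>
     (\<Sum>i\<in>A. \<Sum>j\<in>A. (cmod (M i j))\<^sup>2) \<le> Re (\<Sum>i\<in>A. \<Sum>j\<in>A. cnj (V i j) * M i j)"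
proof -
  obtain V where V: "orthonormal_rows A V"
    and mx: "\<And>W. orthonormal_rows A W \<Longrightarrow>
     Re (\<Sum>i\<in>A. \<Sum>j\<in>A. cnj (W i j) * M i j) \<le> Re (\<Sum>i\<in>A. \<Sum>j\<in>A. cnj (V i j) * M i j)"
    using orthonormal_rows_maximizer[OF A, of M] by blast
  define H where "H = (\<lambda>j l. \<Sum>i\<in>A. cnj (V i j) * M i l)"
  let ?B = "\<lambda>x y. inner_on A x (app_on A H y)"
  have B: "?B x y = inner_on A (app_on A V x) (app_on A M y)" for x y
    unfolding H_def by (rule inner_on_adjoint)
  have im: "Im (?B x x) = 0" and re: "0 \<le> Re (?B x x)" for x
    unfolding B using maximizer_form_nonneg[OF A V mx] by simp_all
  have VH: "app_on A V (app_on A H z) i = app_on A M z i" if i: "i \<in> A" for z i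
  proof -
    have "app_on A H z j = (\<Sum>l\<in>A. cnj (V l j) * app_on A M z l)" for j
      unfolding app_on_def H_def sum_distrib_left sum_distrib_right
      by (subst sum.swap) (simp add: mult.assoc)
    then have "app_on A V (app_on A H z) i = (\<Sum>j\<in>A. \<Sum>l\<in>A. V i j * (cnj (V l j) * app_on A M z l))"
      by (simp add: app_on_def[of A V] sum_distrib_left)
    also have "\<dots> = (\<Sum>l\<in>A. (\<Sum>j\<in>A. V i j * cnj (V l j)) * app_on A M z l)"
      by (subst sum.swap) (simp add: sum_distrib_right mult.assoc)
    also have "\<dots> = (\<Sum>l\<in>A. of_bool (i = l) * app_on A M z l)"
      using V i by (simp add: orthonormal_rows_def)
    also have "\<dots> = app_on A M z i"
      using A i by (simp add: of_bool_def if_distrib[where f="\<lambda>c. c * _"] cong: if_cong)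
    finally show ?thesis .
  qed
  have iso: "inner_on A (app_on A H z) (app_on A H z) = inner_on A (app_on A M z) (app_on A M z)" for z
    unfolding B by (simp add: inner_on_def VH)
  have key: "Re (inner_on A (app_on A M x) (app_on A M x)) \<le> Re (?B x x)" for x
  proof -
    define y where "y = app_on A H x"
    \<comment> \<open>Polarization: the form is real at \<open>x\<close>, at \<open>y\<close> and at
      x + i y, which forces equal real parts at (x, y) and (y, x).\<close>
    have "Im (?B (\<lambda>i. x i + \<i> * y i) (\<lambda>i. x i + \<i> * y i)) = 0"
      by (rule im)
    then have sym: "Re (?B x y) = Re (?B y x)"
      unfolding app_on_add app_on_scale inner_on_add_left inner_on_add_right
        inner_on_scale_left inner_on_scale_right
      using im[of x] im[of y] by (simp add: algebra_simps)
    \<comment> \<open>Positivity is tested on x - H x. With y = H x and \<open>Re (?B y y)\<close>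
      at most |y|^2, this leaves |y|^2 \<le> \<open>Re (?B x x)\<close>.\<close>
    have "0 \<le> Re (?B (\<lambda>i. x i + (-1) * y i) (\<lambda>i. x i + (-1) * y i))"
      by (rule re)
    then have "0 \<le> Re (?B x x) - Re (?B x y) - Re (?B y x) + Re (?B y y)"
      unfolding app_on_add app_on_scale inner_on_add_left inner_on_add_right
        inner_on_scale_left inner_on_scale_right
      by (simp add: algebra_simps)
    moreover have "?B y x = inner_on A y y"
      by (simp add: y_def)
    moreover have "Re (?B y y) \<le> Re (inner_on A y y)"
    proof -
      have "Re (inner_on A (app_on A H y) (app_on A H y)) \<le> Re (inner_on A y y)"
        unfolding iso using contr[of y] by (simp add: inner_on_self)
      then show ?thesis
        using Re_inner_on_le[of A y "app_on A H y"] by simp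
    qed
    ultimately have "Re (inner_on A y y) \<le> Re (?B x x)"
      using sym by simp
    then show ?thesis
      by (simp add: y_def iso)
  qed
  \<comment> \<open>At the j-th standard basis vector, \<open>key\<close> compares the j-th column
    of \<open>M\<close> with a diagonal entry of \<open>H\<close>.\<close>
  have "(\<Sum>i\<in>A. (cmod (M i j))\<^sup>2) \<le> Re (H j j)" if j: "j \<in> A" for j
  proof -
    have delta: "app_on A L (\<lambda>l. of_bool (l = j)) i = L i j" for L i
      using A j by (simp add: app_on_def of_bool_def if_distrib[where f="\<lambda>c. _ * c"] cong: if_cong)
    have "?B (\<lambda>l. of_bool (l = j)) (\<lambda>l. of_bool (l = j)) = H j j"
      unfolding delta inner_on_def
      using A j by (simp add: of_bool_def if_distrib[where f=cnj] if_distrib[where f="\<lambda>c. c * _"] cong: if_cong)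
    then show ?thesis
      using key[of "\<lambda>l. of_bool (l = j)"] unfolding inner_on_self delta by simp
  qed
  then have "(\<Sum>j\<in>A. \<Sum>i\<in>A. (cmod (M i j))\<^sup>2) \<le> (\<Sum>j\<in>A. Re (H j j))"
    by (rule sum_mono)
  also have "\<dots> = Re (\<Sum>i\<in>A. \<Sum>j\<in>A. cnj (V i j) * M i j)"
    unfolding H_def by (subst sum.swap) simp
  finally have "(\<Sum>i\<in>A. \<Sum>j\<in>A. (cmod (M i j))\<^sup>2) \<le> Re (\<Sum>i\<in>A. \<Sum>j\<in>A. cnj (V i j) * M i j)"
    by (subst sum.swap)
  with V show ?thesis
    by blast
qed

section \<open>Unitary matrices and the phase-invariant distance\<close>

lemma adj_index [simp]:
  "i < dim_col A \<Longrightarrow> j < dim_row A \<Longrightarrow> adj A $$ (i,j) = cnj (A $$ (j,i))"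
  by (simp add: adj_def)

lemma adj_dim [simp]: "dim_row (adj A) = dim_col A" "dim_col (adj A) = dim_row A"
  by (simp_all add: adj_def)

lemma adj_carrier [simp]: "A \<in> carrier_mat m n \<Longrightarrow> adj A \<in> carrier_mat n m"
  by (auto simp: adj_def)

lemma unitary_mat_iff:
  "unitary_mat d U \<longleftrightarrow> U \<in> carrier_mat d d \<and>
     (\<forall>i<d. \<forall>j<d. (\<Sum>x<d. cnj (U $$ (x,i)) * U $$ (x,j)) = of_bool (i = j))"
proof -
  have "adj U * U = 1\<^sub>m d \<longleftrightarrow>
     (\<forall>i<d. \<forall>j<d. (\<Sum>x<d. cnj (U $$ (x,i)) * U $$ (x,j)) = of_bool (i = j))"
    if U: "U \<in> carrier_mat d d"
  proof -
    have "(adj U * U) $$ (i,j) = (\<Sum>x<d. cnj (U $$ (x,i)) * U $$ (x,j))" if "i < d" "j < d" for i j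
      using U that by (auto simp: scalar_prod_def atLeast0LessThan intro!: sum.cong)
    then show ?thesis
      using U by (auto simp: mat_eq_iff)
  qed
  then show ?thesis
    by (auto simp: unitary_mat_def)
qed

text \<open>A one-sided inverse of a square matrix is two-sided, so orthonormal rows yield the
  orthonormal columns that \<open>unitary_mat\<close> asks for.\<close>

lemma unitary_mat_of_rows:
  assumes U: "U \<in> carrier_mat d d"
    and rows: "\<And>i j. i < d \<Longrightarrow> j < d \<Longrightarrow> (\<Sum>x<d. U $$ (i,x) * cnj (U $$ (j,x))) = of_bool (i = j)"
  shows "unitary_mat d U"
proof -
  have "(U * adj U) $$ (i,j) = (\<Sum>x<d. U $$ (i,x) * cnj (U $$ (j,x)))" if "i < d" "j < d" for i j
    using U that by (auto simp: scalar_prod_def atLeast0LessThan intro!: sum.cong)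
  then have "U * adj U = 1\<^sub>m d"
    using U rows by (auto simp: mat_eq_iff)
  then have "adj U * U = 1\<^sub>m d"
    using U mat_mult_left_right_inverse adj_carrier by blast
  then show ?thesis
    using U by (simp add: unitary_mat_def)
qed

lemma unitary_mat_frobenius:
  assumes "unitary_mat d U"
  shows "(\<Sum>i<d. \<Sum>j<d. (cmod (U $$ (i,j)))\<^sup>2) = real d"
proof -
  have "complex_of_real (\<Sum>i<d. \<Sum>j<d. (cmod (U $$ (i,j)))\<^sup>2) = (\<Sum>j<d. \<Sum>i<d. cnj (U $$ (i,j)) * U $$ (i,j))"
    unfolding of_real_sum complex_norm_square by (subst sum.swap) (simp add: mult.commute)
  also have "\<dots> = of_real (real d)"
    using assms by (simp add: unitary_mat_iff)
  finally show ?thesis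
    using of_real_eq_iff by blast
qed

text \<open>For unitaries the squared norm of e^(i \<theta>) U - V is 2N - 2 Re(e^(i \<theta>) z),
  where z is the trace of the adjoint of \<open>V\<close> times \<open>U\<close>. The best phase
  replaces the real part by |z|.\<close>

lemma dist_ph_le:
  assumes U: "unitary_mat N U" and V: "unitary_mat N V" and N: "N \<ge> 1"
  shows "dist_ph N U V \<le> sqrt (1 - cmod (\<Sum>i<N. \<Sum>j<N. cnj (V $$ (i,j)) * U $$ (i,j)) / real N)"
proof -
  define z where "z = (\<Sum>i<N. \<Sum>j<N. cnj (V $$ (i,j)) * U $$ (i,j))"
  \<comment> \<open>\<open>Arg2pi\<close> takes its values in the half-open interval over which
    \<open>dist_ph\<close> ranges; this angle cancels the phase of \<open>z\<close>.\<close>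
  define \<theta> where "\<theta> = Arg2pi (cnj z)"
  have \<theta>: "\<theta> \<in> {0..<2*pi}"
    using Arg2pi[of "cnj z"] by (auto simp: \<theta>_def)
  define e where "e = exp (\<i> * complex_of_real \<theta>)"
  have e: "cmod e = 1"
    by (simp add: e_def)
  have "cnj z = cmod z * e"
    using Arg2pi_eq[of "cnj z"] by (simp add: e_def \<theta>_def)
  then have "e * z = e * (cmod z * cnj e)"
    by (metis complex_cnj_cnj complex_cnj_complex_of_real complex_cnj_mult)
  also have "\<dots> = cmod z"
    using e by (simp add: complex_norm_square[symmetric] mult.left_commute)
  finally have ez: "e * z = cmod z" .
  have dims: "dim_row U = N" "dim_col U = N" "dim_row V = N" "dim_col V = N"
    using U V by (auto simp: unitary_mat_def)
  have "(\<Sum>i<N. \<Sum>j<N. (cmod (e * U $$ (i,j) - V $$ (i,j)))\<^sup>2)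
     = (\<Sum>i<N. \<Sum>j<N. (cmod (U $$ (i,j)))\<^sup>2 + (cmod (V $$ (i,j)))\<^sup>2 - 2 * Re (e * (cnj (V $$ (i,j)) * U $$ (i,j))))"
  proof (intro sum.cong refl)
    fix i j
    have "(cmod (e * a - b))\<^sup>2 = (cmod a)\<^sup>2 + (cmod b)\<^sup>2 - 2 * Re (e * (cnj b * a))" for a b
    proof -
      have "(cmod (e * a - b))\<^sup>2 = (cmod (e * a))\<^sup>2 + (cmod b)\<^sup>2 - 2 * Re (cnj b * (e * a))"
        unfolding cmod_power2 by (simp add: power2_eq_square algebra_simps)
      then show ?thesis
        using e by (simp add: norm_mult mult.left_commute)
    qed
    then show "(cmod (e * U $$ (i,j) - V $$ (i,j)))\<^sup>2
       = (cmod (U $$ (i,j)))\<^sup>2 + (cmod (V $$ (i,j)))\<^sup>2 - 2 * Re (e * (cnj (V $$ (i,j)) * U $$ (i,j)))" .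
  qed
  also have "\<dots> = 2 * real N - 2 * Re (e * z)"
    unfolding z_def sum_distrib_left Re_sum
    by (simp add: sum.distrib sum_subtractf sum_distrib_left unitary_mat_frobenius[OF U] unitary_mat_frobenius[OF V])
  finally have "hs_norm (e \<cdot>\<^sub>m U - V) = sqrt (2 * real N - 2 * cmod z)"
    by (simp add: hs_norm_def dims ez)
  then have "hs_norm (e \<cdot>\<^sub>m U - V) / sqrt (2 * real N) = sqrt (1 - cmod z / real N)"
    using N by (simp add: real_sqrt_divide[symmetric] diff_divide_distrib)
  moreover have "dist_ph N U V \<le> hs_norm (e \<cdot>\<^sub>m U - V) / sqrt (2 * real N)"
    unfolding dist_ph_def e_def
    by (rule cINF_lower[OF _ \<theta>]) (auto intro!: bdd_belowI[of _ 0] simp: hs_norm_def sum_nonneg)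
  ultimately show ?thesis
    by (simp add: z_def)
qed

lemma dist_ph_le_1:
  assumes "unitary_mat N U" "unitary_mat N V" "N \<ge> 1"
  shows "dist_ph N U V \<le> 1"
  by (rule order_trans[OF dist_ph_le[OF assms]]) simp

section \<open>Pauli coefficients and partial traces\<close>

text \<open>For finite \<open>B\<close> this is the character (-1)^|B Int Y|, written as a product
  so that sums over \<open>B\<close> factor qubit by qubit.\<close>

definition walsh :: "nat set \<Rightarrow> nat set \<Rightarrow> complex" where
  "walsh B Y = (\<Prod>j\<in>B. if j \<in> Y then -1 else 1)"

lemma walsh_commute:
  assumes "finite B" "finite Y"
  shows "walsh B Y = walsh Y B"
proof -
  have "walsh B Y = (-1) ^ card (B \<inter> Y)" if "finite B" for B Y
    using that by (simp add: walsh_def prod.If_cases)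
  then show ?thesis
    using assms by (simp add: Int_commute)
qed

lemma cnj_walsh [simp]: "cnj (walsh B Y) = walsh B Y"
  unfolding walsh_def cnj_prod by (rule prod.cong) auto

text \<open>The sum over \<open>B\<close> factors into one term per qubit: 2 where \<open>X\<close>
  and \<open>Y\<close> agree, and 1 - 1 where they differ.\<close>

lemma walsh_orthogonal:
  assumes T: "finite T" "X \<subseteq> T" "Y \<subseteq> T"
  shows "(\<Sum>B\<in>Pow T. walsh B X * walsh B Y) = (if X = Y then 2 ^ card T else 0)"
proof -
  let ?g = "\<lambda>j. (if j \<in> X then -1 else 1) * (if j \<in> Y then -1 else 1) :: complex"
  have "(\<Sum>B\<in>Pow T. walsh B X * walsh B Y) = (\<Sum>B\<in>Pow T. (\<Prod>j\<in>B. ?g j) * (\<Prod>j\<in>T-B. 1))"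
    by (simp only: walsh_def prod.distrib prod.neutral_const mult_1_right)
  also have "\<dots> = (\<Prod>j\<in>T. ?g j + 1)"
    by (rule prod_add[OF T(1), symmetric])
  also have "\<dots> = (\<Prod>j\<in>T. if j \<in> X \<longleftrightarrow> j \<in> Y then 2 else 0)"
    by (rule prod.cong) auto
  also have "\<dots> = (if X = Y then 2 ^ card T else 0)"
  proof (cases "X = Y")
    case False
    then have "\<exists>j\<in>T. \<not> (j \<in> X \<longleftrightarrow> j \<in> Y)"
      using T by blast
    then show ?thesis
      using False T(1) by (auto simp: prod_zero_iff)
  qed simp
  finally show ?thesis .
qed

lemma walsh_parseval:
  assumes T: "finite T"
  shows "(\<Sum>b\<in>Pow T. (cmod (\<Sum>Y\<in>Pow T. walsh b Y * g Y))\<^sup>2) = 2 ^ card T * (\<Sum>Y\<in>Pow T. (cmod (g Y))\<^sup>2)"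
proof -
  have "complex_of_real (\<Sum>b\<in>Pow T. (cmod (\<Sum>Y\<in>Pow T. walsh b Y * g Y))\<^sup>2)
     = (\<Sum>b\<in>Pow T. \<Sum>Y\<in>Pow T. \<Sum>X\<in>Pow T. g Y * cnj (g X) * (walsh b Y * walsh b X))"
    unfolding of_real_sum complex_norm_square cnj_sum sum_product by (simp add: mult_ac)
  also have "\<dots> = (\<Sum>Y\<in>Pow T. \<Sum>b\<in>Pow T. \<Sum>X\<in>Pow T. g Y * cnj (g X) * (walsh b Y * walsh b X))"
    by (rule sum.swap)
  also have "\<dots> = (\<Sum>Y\<in>Pow T. \<Sum>X\<in>Pow T. \<Sum>b\<in>Pow T. g Y * cnj (g X) * (walsh b Y * walsh b X))"
    by (rule sum.cong[OF refl sum.swap])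
  also have "\<dots> = (\<Sum>Y\<in>Pow T. \<Sum>X\<in>Pow T. g Y * cnj (g X) * (if Y = X then 2 ^ card T else 0))"
    unfolding sum_distrib_left[symmetric] by (intro sum.cong refl) (simp add: walsh_orthogonal[OF T])
  also have "\<dots> = (\<Sum>Y\<in>Pow T. g Y * cnj (g Y) * 2 ^ card T)"
    using T by (simp add: if_distrib[where f="\<lambda>c. _ * c"] cong: if_cong)
  also have "\<dots> = complex_of_real (2 ^ card T * (\<Sum>Y\<in>Pow T. (cmod (g Y))\<^sup>2))"
    unfolding of_real_mult of_real_sum complex_norm_square by (simp add: sum_distrib_left mult_ac)
  finally show ?thesis
    using of_real_eq_iff by blast
qed

lemma sum_Pow_split:
  assumes "T \<subseteq> S"
  shows "(\<Sum>Y\<in>Pow S. f Y) = (\<Sum>Y\<in>Pow T. \<Sum>Z\<in>Pow (S - T). f (Y \<union> Z))"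
proof -
  have "bij_betw (\<lambda>(Y,Z). Y \<union> Z) (Pow T \<times> Pow (S - T)) (Pow S)"
    by (rule bij_betw_byWitness[where f'="\<lambda>Y. (Y \<inter> T, Y - T)"]) (use assms in auto)
  from sum.reindex_bij_betw[OF this, of f] show ?thesis
    by (simp add: sum.cartesian_product case_prod_unfold)
qed

lemma sum_Pow_sym_diff:
  assumes "Y \<subseteq> T"
  shows "(\<Sum>a\<in>Pow T. f (sym_diff a Y)) = (\<Sum>a\<in>Pow T. f a)"
proof -
  have "bij_betw (\<lambda>a. sym_diff a Y) (Pow T) (Pow T)"
    by (rule bij_betw_byWitness[where f'="\<lambda>a. sym_diff a Y"]) (use assms in auto)
  then show ?thesis
    by (rule sum.reindex_bij_betw)
qed

text \<open>Matrices on qubits are indexed by sets: \<open>Y\<close> stands for the basis state whose ones are at the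
  positions in \<open>Y\<close>. Then \<open>X\<^sup>aZ\<^sup>b\<close> maps \<open>|Y\<rangle>\<close> to \<open>walsh b Y |sym_diff a Y\<rangle>\<close>.\<close>

definition pauli_coeff :: "nat \<Rightarrow> (nat set \<Rightarrow> nat set \<Rightarrow> complex) \<Rightarrow> nat set \<Rightarrow> nat set \<Rightarrow> complex" where
  "pauli_coeff n u a b = (\<Sum>Y\<in>Pow {..<n}. walsh b Y * u (sym_diff a Y) Y) / 2 ^ n"

text \<open>Dividing by the dimension of the traced-out factor turns the trace into an average of
  diagonal blocks, hence a contraction for unitary \<open>u\<close>.\<close>

definition partial_trace :: "nat \<Rightarrow> nat set \<Rightarrow> (nat set \<Rightarrow> nat set \<Rightarrow> complex) \<Rightarrow> nat set \<Rightarrow> nat set \<Rightarrow> complex" where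
  "partial_trace n T u X Y = (\<Sum>Z\<in>Pow ({..<n} - T). u (X \<union> Z) (Y \<union> Z)) / 2 ^ (n - card T)"

text \<open>The sign ignores the part \<open>Z\<close> outside \<open>T\<close> and the flip leaves
  it in place, so the sum over \<open>Z\<close> is a partial trace.\<close>

lemma pauli_coeff_partial_trace:
  assumes T: "T \<subseteq> {..<n}" and a: "a \<subseteq> T" and b: "b \<subseteq> T"
  shows "pauli_coeff n u a b = (\<Sum>Y\<in>Pow T. walsh b Y * partial_trace n T u (sym_diff a Y) Y) / 2 ^ card T"
proof -
  have k: "card T \<le> n"
    using card_mono[OF _ T] by simp
  have "(\<Sum>Y\<in>Pow {..<n}. walsh b Y * u (sym_diff a Y) Y)
    = (\<Sum>Y\<in>Pow T. \<Sum>Z\<in>Pow ({..<n} - T). walsh b (Y \<union> Z) * u (sym_diff a (Y \<union> Z)) (Y \<union> Z))"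
    by (rule sum_Pow_split[OF T])
  also have "\<dots> = (\<Sum>Y\<in>Pow T. \<Sum>Z\<in>Pow ({..<n} - T). walsh b Y * u (sym_diff a Y \<union> Z) (Y \<union> Z))"
  proof (intro sum.cong refl)
    fix Y Z assume "Y \<in> Pow T" "Z \<in> Pow ({..<n} - T)"
    then have "sym_diff a (Y \<union> Z) = sym_diff a Y \<union> Z" and "\<And>j. j \<in> b \<Longrightarrow> j \<in> Y \<union> Z \<longleftrightarrow> j \<in> Y"
      using a b by blast+
    moreover from this(2) have "walsh b (Y \<union> Z) = walsh b Y"
      unfolding walsh_def by (intro prod.cong refl) simp
    ultimately show "walsh b (Y \<union> Z) * u (sym_diff a (Y \<union> Z)) (Y \<union> Z) = walsh b Y * u (sym_diff a Y \<union> Z) (Y \<union> Z)"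
      by simp
  qed
  also have "\<dots> = 2 ^ (n - card T) * (\<Sum>Y\<in>Pow T. walsh b Y * partial_trace n T u (sym_diff a Y) Y)"
    unfolding partial_trace_def sum_distrib_left[of "2 ^ (n - card T)" _ "Pow T"]
    by (intro sum.cong refl) (simp flip: sum_distrib_left)
  finally show ?thesis
    using k by (simp add: pauli_coeff_def power_diff)
qed

text \<open>Parseval in \<open>b\<close> for each fixed flip \<open>a\<close>; then the pairs
  (\<open>sym_diff a Y\<close>, \<open>Y\<close>) run through all entries of the partial
  trace.\<close>

lemma pauli_weight_partial_trace:
  assumes T: "T \<subseteq> {..<n}"
  shows "(\<Sum>a\<in>Pow T. \<Sum>b\<in>Pow T. (cmod (pauli_coeff n u a b))\<^sup>2)
     = (\<Sum>X\<in>Pow T. \<Sum>Y\<in>Pow T. (cmod (partial_trace n T u X Y))\<^sup>2) / 2 ^ card T"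
proof -
  have fin: "finite T"
    using T finite_subset by blast
  have "(\<Sum>b\<in>Pow T. (cmod (pauli_coeff n u a b))\<^sup>2)
     = (\<Sum>Y\<in>Pow T. (cmod (partial_trace n T u (sym_diff a Y) Y))\<^sup>2) / 2 ^ card T" if "a \<in> Pow T" for a
  proof -
    have "(\<Sum>b\<in>Pow T. (cmod (pauli_coeff n u a b))\<^sup>2)
      = (\<Sum>b\<in>Pow T. (cmod (\<Sum>Y\<in>Pow T. walsh b Y * partial_trace n T u (sym_diff a Y) Y))\<^sup>2) / (2 ^ card T)\<^sup>2"
      unfolding sum_divide_distrib[of _ "Pow T" "(2 ^ card T)\<^sup>2"]
      by (intro sum.cong refl)
        (use that in \<open>simp add: pauli_coeff_partial_trace[OF T] norm_divide norm_power power_divide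
           flip: sum_divide_distrib\<close>)
    also have "\<dots> = (\<Sum>Y\<in>Pow T. (cmod (partial_trace n T u (sym_diff a Y) Y))\<^sup>2) / 2 ^ card T"
      unfolding walsh_parseval[OF fin] by (simp add: power2_eq_square)
    finally show ?thesis .
  qed
  then have "(\<Sum>a\<in>Pow T. \<Sum>b\<in>Pow T. (cmod (pauli_coeff n u a b))\<^sup>2)
     = (\<Sum>a\<in>Pow T. \<Sum>Y\<in>Pow T. (cmod (partial_trace n T u (sym_diff a Y) Y))\<^sup>2) / 2 ^ card T"
    by (simp add: sum_divide_distrib)
  also have "(\<Sum>a\<in>Pow T. \<Sum>Y\<in>Pow T. (cmod (partial_trace n T u (sym_diff a Y) Y))\<^sup>2)
     = (\<Sum>Y\<in>Pow T. \<Sum>a\<in>Pow T. (cmod (partial_trace n T u (sym_diff a Y) Y))\<^sup>2)"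
    by (rule sum.swap)
  also have "\<dots> = (\<Sum>Y\<in>Pow T. \<Sum>X\<in>Pow T. (cmod (partial_trace n T u X Y))\<^sup>2)"
    by (rule sum.cong[OF refl], rule sum_Pow_sym_diff) blast
  also have "\<dots> = (\<Sum>X\<in>Pow T. \<Sum>Y\<in>Pow T. (cmod (partial_trace n T u X Y))\<^sup>2)"
    by (rule sum.swap)
  finally show ?thesis .
qed

text \<open>Fourier inversion in \<open>b\<close>; the only flip connecting \<open>Y\<close> to
  \<open>X\<close> is \<open>sym_diff X Y\<close>.\<close>

lemma pauli_expansion:
  assumes "X \<subseteq> {..<n}" "Y \<subseteq> {..<n}"
  shows "(\<Sum>b\<in>Pow {..<n}. pauli_coeff n u (sym_diff X Y) b * walsh b Y) = u X Y"
proof -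
  let ?S = "Pow {..<n}"
  let ?g = "\<lambda>W. u (sym_diff (sym_diff X Y) W) W"
  have "(\<Sum>b\<in>?S. pauli_coeff n u (sym_diff X Y) b * walsh b Y)
     = (\<Sum>b\<in>?S. \<Sum>W\<in>?S. ?g W * (walsh b W * walsh b Y)) / 2 ^ n"
    unfolding pauli_coeff_def sum_divide_distrib sum_distrib_right by (simp add: mult_ac)
  also have "(\<Sum>b\<in>?S. \<Sum>W\<in>?S. ?g W * (walsh b W * walsh b Y))
     = (\<Sum>W\<in>?S. \<Sum>b\<in>?S. ?g W * (walsh b W * walsh b Y))"
    by (rule sum.swap)
  also have "\<dots> = (\<Sum>W\<in>?S. ?g W * (if W = Y then 2 ^ n else 0))"
    unfolding sum_distrib_left[symmetric]
    by (intro sum.cong refl) (use assms in \<open>simp add: walsh_orthogonal\<close>)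
  also have "\<dots> = ?g Y * 2 ^ n"
    using assms by (simp add: if_distrib[where f="\<lambda>c. _ * c"] cong: if_cong)
  also have "sym_diff (sym_diff X Y) Y = X"
    by blast
  finally show ?thesis
    by simp
qed

text \<open>The partial trace averages, over \<open>Z\<close>, the blocks of \<open>u\<close> that
  keep \<open>Z\<close> fixed. Each block is a compression of an isometry, and an average of
  contractions is a contraction.\<close>

lemma partial_trace_contraction:
  assumes T: "T \<subseteq> {..<n}"
    and iso: "\<And>x. (\<Sum>X\<in>Pow {..<n}. (cmod (app_on (Pow {..<n}) u x X))\<^sup>2) = (\<Sum>Y\<in>Pow {..<n}. (cmod (x Y))\<^sup>2)"
  shows "(\<Sum>X\<in>Pow T. (cmod (app_on (Pow T) (partial_trace n T u) x X))\<^sup>2) \<le> (\<Sum>Y\<in>Pow T. (cmod (x Y))\<^sup>2)"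
proof -
  let ?R = "Pow ({..<n} - T)"
  have fin: "finite T"
    using T finite_subset by blast
  have cardR: "card ?R = 2 ^ (n - card T)"
    using T fin by (simp add: card_Pow card_Diff_subset)
  define d :: real where "d = 2 ^ (n - card T)"
  have d: "d > 0" "real (card ?R) = d"
    by (simp_all add: d_def cardR)
  let ?w = "\<lambda>Z X. \<Sum>Y\<in>Pow T. u (X \<union> Z) (Y \<union> Z) * x Y"
  have block: "(\<Sum>X\<in>Pow T. (cmod (?w Z X))\<^sup>2) \<le> (\<Sum>Y\<in>Pow T. (cmod (x Y))\<^sup>2)" if Z: "Z \<in> ?R" for Z
  proof -
    \<comment> \<open>The vector \<open>x\<close> on \<open>T\<close> tensored with the basis state
      \<open>Z\<close> on the other qubits. Dropping the output components away from
      \<open>Z\<close> only decreases the norm.\<close>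
    define x' where "x' = (\<lambda>B. if B - T = Z then x (B \<inter> T) else 0)"
    have x': "x' (Y \<union> Z') = (if Z' = Z then x Y else 0)" if "Y \<in> Pow T" "Z' \<in> ?R" for Y Z'
    proof -
      have "(Y \<union> Z') - T = Z'" "(Y \<union> Z') \<inter> T = Y"
        using that by blast+
      then show ?thesis
        by (cases "Z' = Z") (auto simp: x'_def)
    qed
    have "app_on (Pow {..<n}) u x' A = (\<Sum>Y\<in>Pow T. \<Sum>Z'\<in>?R. if Z' = Z then u A (Y \<union> Z') * x Y else 0)" for A
      unfolding app_on_def sum_Pow_split[OF T] by (intro sum.cong refl) (simp add: x')
    then have app: "app_on (Pow {..<n}) u x' A = (\<Sum>Y\<in>Pow T. u A (Y \<union> Z) * x Y)" for A
      using Z by simp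
    have "(\<Sum>X\<in>Pow T. (cmod (?w Z X))\<^sup>2) \<le> (\<Sum>X\<in>Pow T. \<Sum>Z'\<in>?R. (cmod (app_on (Pow {..<n}) u x' (X \<union> Z')))\<^sup>2)"
    proof (rule sum_mono)
      fix X
      show "(cmod (?w Z X))\<^sup>2 \<le> (\<Sum>Z'\<in>?R. (cmod (app_on (Pow {..<n}) u x' (X \<union> Z')))\<^sup>2)"
        unfolding app
        by (rule member_le_sum[where f="\<lambda>Z'. (cmod (\<Sum>Y\<in>Pow T. u (X \<union> Z') (Y \<union> Z) * x Y))\<^sup>2", OF Z])
          simp_all
    qed
    also have "\<dots> = (\<Sum>A\<in>Pow {..<n}. (cmod (app_on (Pow {..<n}) u x' A))\<^sup>2)"
      by (rule sum_Pow_split[OF T, symmetric])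
    also have "\<dots> = (\<Sum>Y\<in>Pow {..<n}. (cmod (x' Y))\<^sup>2)"
      by (rule iso)
    also have "\<dots> = (\<Sum>Y\<in>Pow T. \<Sum>Z'\<in>?R. if Z' = Z then (cmod (x Y))\<^sup>2 else 0)"
      unfolding sum_Pow_split[OF T] by (intro sum.cong refl) (simp add: x')
    also have "\<dots> = (\<Sum>Y\<in>Pow T. (cmod (x Y))\<^sup>2)"
      using Z by simp
    finally show ?thesis .
  qed
  have "(cmod (app_on (Pow T) (partial_trace n T u) x X))\<^sup>2 \<le> (\<Sum>Z\<in>?R. (cmod (?w Z X))\<^sup>2) / d" for X
  proof -
    have "app_on (Pow T) (partial_trace n T u) x X = (\<Sum>Y\<in>Pow T. \<Sum>Z\<in>?R. u (X \<union> Z) (Y \<union> Z) * x Y) / of_real d"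
      unfolding app_on_def partial_trace_def d_def by (simp add: sum_divide_distrib sum_distrib_right)
    also have "(\<Sum>Y\<in>Pow T. \<Sum>Z\<in>?R. u (X \<union> Z) (Y \<union> Z) * x Y) = (\<Sum>Z\<in>?R. ?w Z X)"
      by (rule sum.swap)
    finally have "(cmod (app_on (Pow T) (partial_trace n T u) x X))\<^sup>2 = (cmod (\<Sum>Z\<in>?R. ?w Z X))\<^sup>2 / d\<^sup>2"
      using d by (simp add: norm_divide power_divide)
    also have "(cmod (\<Sum>Z\<in>?R. ?w Z X))\<^sup>2 \<le> (\<Sum>Z\<in>?R. cmod (?w Z X))\<^sup>2"
      by (intro power_mono norm_sum norm_ge_zero)
    \<comment> \<open>Cauchy-Schwarz over the \<open>d\<close> blocks uses up one factor of the
      normalization by \<open>d\<close> squared.\<close>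
    also have "\<dots> \<le> d * (\<Sum>Z\<in>?R. (cmod (?w Z X))\<^sup>2)"
      using sum_squared_le_sum_of_squares[of "\<lambda>Z. cmod (?w Z X)" ?R] d
      by (simp add: mult.commute)
    finally show ?thesis
      using d by (simp add: power2_eq_square field_simps)
  qed
  then have "(\<Sum>X\<in>Pow T. (cmod (app_on (Pow T) (partial_trace n T u) x X))\<^sup>2)
      \<le> (\<Sum>X\<in>Pow T. (\<Sum>Z\<in>?R. (cmod (?w Z X))\<^sup>2) / d)"
    by (rule sum_mono)
  also have "\<dots> = (\<Sum>X\<in>Pow T. \<Sum>Z\<in>?R. (cmod (?w Z X))\<^sup>2) / d"
    by (simp add: sum_divide_distrib)
  also have "\<dots> = (\<Sum>Z\<in>?R. \<Sum>X\<in>Pow T. (cmod (?w Z X))\<^sup>2) / d"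
    by (subst sum.swap) (rule refl)
  also have "\<dots> \<le> (\<Sum>Z\<in>?R. \<Sum>Y\<in>Pow T. (cmod (x Y))\<^sup>2) / d"
    using d by (intro divide_right_mono sum_mono block) auto
  also have "\<dots> = (\<Sum>Y\<in>Pow T. (cmod (x Y))\<^sup>2)"
    using d by simp
  finally show ?thesis .
qed

section \<open>Sets of qubits as matrix indices\<close>

lemma bij_betw_set_encode: "bij_betw set_encode (Pow {..<n}) {..<2 ^ n}"
proof (rule bij_betw_byWitness[where f'=set_decode])
  show "\<forall>A\<in>Pow {..<n}. set_decode (set_encode A) = A"
    using finite_subset by fastforce
  show "set_encode ` Pow {..<n} \<subseteq> {..<2 ^ n}"
  proof clarify
    fix A :: "nat set" assume A: "A \<subseteq> {..<n}"
    have "set_encode A \<le> (\<Sum>i<n. 2 ^ i)"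
      unfolding set_encode_def using A by (intro sum_mono2) auto
    also have "\<dots> < 2 ^ n"
      by (induction n) auto
    finally show "set_encode A < 2 ^ n" .
  qed
  show "set_decode ` {..<2 ^ n} \<subseteq> Pow {..<n}"
  proof clarify
    fix x i :: nat assume x: "x < 2 ^ n" and i: "i \<in> set_decode x"
    have "\<not> x < 2 ^ i"
      using i by (auto simp: set_decode_def)
    with x have "(2::nat) ^ i < 2 ^ n"
      by linarith
    then show "i < n"
      by (simp add: power_strict_increasing_iff)
  qed
qed simp

lemma sum_set_encode: "(\<Sum>x<2 ^ n. f x) = (\<Sum>X\<in>Pow {..<n}. f (set_encode X))"
  by (rule sum.reindex_bij_betw[OF bij_betw_set_encode, symmetric])

lemma set_encode_less: "X \<subseteq> {..<n} \<Longrightarrow> set_encode X < 2 ^ n"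
  using bij_betw_apply[OF bij_betw_set_encode, of X n] by simp

lemma set_encode_eq_iff: "X \<subseteq> {..<n} \<Longrightarrow> Y \<subseteq> {..<n} \<Longrightarrow> set_encode X = set_encode Y \<longleftrightarrow> X = Y"
  by (meson finite_lessThan finite_subset set_encode_eq)

lemma qbit_set_encode: "finite X \<Longrightarrow> qbit (set_encode X) j \<longleftrightarrow> j \<in> X"
  using set_encode_inverse[of X] by (auto simp: qbit_def set_decode_def)

lemma sub_index_set_encode_Int:
  assumes "finite X" "finite T"
  shows "sub_index T (set_encode (X \<inter> T)) = sub_index T (set_encode X)"
  unfolding sub_index_def
proof (intro sum.cong refl)
  fix i assume "i \<in> {..<card T}"
  then have "sorted_list_of_set T ! i \<in> T"
    using assms by (metis lessThan_iff nth_mem set_sorted_list_of_set sorted_list_of_set.length_sorted_key_list_of_set)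
  then show "(if qbit (set_encode (X \<inter> T)) (sorted_list_of_set T ! i) then 2 ^ i else 0)
    = (if qbit (set_encode X) (sorted_list_of_set T ! i) then 2 ^ i else 0)"
    using assms by (simp add: qbit_set_encode)
qed

text \<open>\<open>sub_index T\<close> numbers the qubits of \<open>T\<close> increasingly and reads
  off the bits, so it is \<open>set_encode\<close> after a bijection onto the subsets of
  \<open>{..<card T}\<close>.\<close>

lemma bij_betw_sub_index:
  assumes T: "finite T"
  shows "bij_betw (\<lambda>X. sub_index T (set_encode X)) (Pow T) {..<2 ^ card T}"
proof -
  let ?xs = "sorted_list_of_set T" and ?k = "card T"
  have nth: "bij_betw ((!) ?xs) {..<?k} T"
    using T by (intro bij_betw_nth) auto
  have "bij_betw (\<lambda>X. {i. i < ?k \<and> ?xs ! i \<in> X}) (Pow T) (Pow {..<?k})"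
  proof (rule bij_betw_byWitness[where f'="\<lambda>I. (!) ?xs ` I"])
    show "\<forall>X\<in>Pow T. (!) ?xs ` {i. i < ?k \<and> ?xs ! i \<in> X} = X"
      using bij_betw_imp_surj_on[OF nth] by (auto simp: image_iff)
    show "\<forall>I\<in>Pow {..<?k}. {i. i < ?k \<and> ?xs ! i \<in> (!) ?xs ` I} = I"
      using bij_betw_imp_inj_on[OF nth] by (auto simp: inj_on_def)
    show "(\<lambda>I. (!) ?xs ` I) ` Pow {..<?k} \<subseteq> Pow T"
      using bij_betw_imp_surj_on[OF nth] by blast
  qed auto
  then have bij: "bij_betw (set_encode \<circ> (\<lambda>X. {i. i < ?k \<and> ?xs ! i \<in> X})) (Pow T) {..<2 ^ ?k}"
    using bij_betw_set_encode by (rule bij_betw_trans)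
  have eq: "(set_encode \<circ> (\<lambda>X. {i. i < ?k \<and> ?xs ! i \<in> X})) X = sub_index T (set_encode X)"
    if X: "X \<in> Pow T" for X
  proof -
    have "finite X"
      using X T finite_subset by auto
    moreover have "{i. i < ?k \<and> ?xs ! i \<in> X} = {..<?k} \<inter> {i. ?xs ! i \<in> X}"
      by auto
    ultimately show ?thesis
      by (simp add: sub_index_def qbit_set_encode) (simp add: set_encode_def sum.inter_restrict)
  qed
  show ?thesis
    by (rule iffD1[OF bij_betw_cong bij]) (rule eq)
qed

lemma embed_op_set_encode:
  assumes T: "T \<subseteq> {..<n}" and X: "X \<subseteq> {..<n}" and Y: "Y \<subseteq> {..<n}"
  shows "embed_op n T V $$ (set_encode X, set_encode Y)
     = (if X - T = Y - T
        then V $$ (sub_index T (set_encode (X \<inter> T)), sub_index T (set_encode (Y \<inter> T))) else 0)"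
proof -
  have fin: "finite X" "finite Y" "finite T"
    using assms finite_subset by blast+
  have "(\<forall>j<n. j \<notin> T \<longrightarrow> qbit (set_encode X) j = qbit (set_encode Y) j) \<longleftrightarrow> X - T = Y - T"
    using X Y fin by (auto simp: qbit_set_encode)
  then show ?thesis
    using X Y fin by (simp add: embed_op_def set_encode_less sub_index_set_encode_Int)
qed

section \<open>Pauli weight of unitaries, juntas and far unitaries\<close>

definition set_entry :: "complex mat \<Rightarrow> nat set \<Rightarrow> nat set \<Rightarrow> complex" where
  "set_entry U X Y = U $$ (set_encode X, set_encode Y)"

lemma unitary_mat_set_entry:
  assumes "U \<in> carrier_mat (2 ^ n) (2 ^ n)"
  shows "unitary_mat (2 ^ n) U \<longleftrightarrow> (\<forall>X\<in>Pow {..<n}. \<forall>Y\<in>Pow {..<n}.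
     (\<Sum>Z\<in>Pow {..<n}. cnj (set_entry U Z X) * set_entry U Z Y) = of_bool (X = Y))"
proof -
  have all: "(\<forall>i<2 ^ n. P i) \<longleftrightarrow> (\<forall>X\<in>Pow {..<n}. P (set_encode X))" for P :: "nat \<Rightarrow> bool"
    using bij_betw_imp_surj_on[OF bij_betw_set_encode, of n] by (metis (no_types, lifting) imageE image_eqI lessThan_iff)
  show ?thesis
    unfolding unitary_mat_iff all sum_set_encode
    using assms by (auto simp: set_entry_def set_encode_eq_iff)
qed

lemma unitary_set_entry_isometry:
  assumes U: "unitary_mat (2 ^ n) U"
  shows "(\<Sum>X\<in>Pow {..<n}. (cmod (app_on (Pow {..<n}) (set_entry U) x X))\<^sup>2) = (\<Sum>Y\<in>Pow {..<n}. (cmod (x Y))\<^sup>2)"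
proof -
  let ?S = "Pow {..<n}" and ?u = "set_entry U"
  have orth: "(\<Sum>Z\<in>?S. cnj (?u Z X) * ?u Z Y) = of_bool (X = Y)" if "X \<in> ?S" "Y \<in> ?S" for X Y
    using U unitary_mat_set_entry[of U n] that by (auto simp: unitary_mat_def)
  have "complex_of_real (\<Sum>X\<in>?S. (cmod (app_on ?S ?u x X))\<^sup>2)
     = (\<Sum>Z\<in>?S. \<Sum>X\<in>?S. \<Sum>Y\<in>?S. cnj (x X) * x Y * (cnj (?u Z X) * ?u Z Y))"
    unfolding inner_on_self[symmetric] inner_on_def app_on_def cnj_sum sum_product by (simp add: mult_ac)
  also have "\<dots> = (\<Sum>X\<in>?S. \<Sum>Z\<in>?S. \<Sum>Y\<in>?S. cnj (x X) * x Y * (cnj (?u Z X) * ?u Z Y))"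
    by (rule sum.swap)
  also have "\<dots> = (\<Sum>X\<in>?S. \<Sum>Y\<in>?S. \<Sum>Z\<in>?S. cnj (x X) * x Y * (cnj (?u Z X) * ?u Z Y))"
    by (rule sum.cong[OF refl sum.swap])
  also have "\<dots> = (\<Sum>X\<in>?S. \<Sum>Y\<in>?S. if X = Y then cnj (x X) * x Y else 0)"
    unfolding sum_distrib_left[symmetric] by (intro sum.cong refl) (simp add: orth)
  also have "\<dots> = complex_of_real (\<Sum>Y\<in>?S. (cmod (x Y))\<^sup>2)"
    unfolding inner_on_self[symmetric] inner_on_def by simp
  finally show ?thesis
    using of_real_eq_iff by blast
qed

text \<open>With all qubits as \<open>T\<close> nothing is traced out, and the weight is the squared
  Frobenius norm over 2^n. The weights are thus a probability distribution.\<close>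

lemma pauli_weight_total:
  assumes U: "unitary_mat (2 ^ n) U"
  shows "(\<Sum>a\<in>Pow {..<n}. \<Sum>b\<in>Pow {..<n}. (cmod (pauli_coeff n (set_entry U) a b))\<^sup>2) = 1"
proof -
  have "partial_trace n {..<n} (set_entry U) X Y = set_entry U X Y" for X Y
    by (simp add: partial_trace_def)
  then show ?thesis
    using unitary_mat_frobenius[OF U]
    by (simp add: pauli_weight_partial_trace set_entry_def sum_set_encode)
qed

text \<open>Columns \<open>X\<close> and \<open>Y\<close> overlap only if they agree outside
  \<open>T\<close>, and then only in rows with that same outside part. What remains is
  orthonormality of the columns of \<open>V\<close>.\<close>

lemma unitary_embed_op:
  assumes T: "T \<subseteq> {..<n}" and V: "unitary_mat (2 ^ card T) V"
  shows "unitary_mat (2 ^ n) (embed_op n T V)"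
proof -
  have fin: "finite T"
    using T finite_subset by blast
  let ?s = "\<lambda>X. sub_index T (set_encode X)"
  have s: "?s X < 2 ^ card T" "?s X = ?s Y \<longleftrightarrow> X = Y" if "X \<subseteq> T" "Y \<subseteq> T" for X Y
    using bij_betw_sub_index[OF fin] that by (auto simp: bij_betw_def inj_on_def)
  have "(\<Sum>Z\<in>Pow {..<n}. cnj (set_entry (embed_op n T V) Z X) * set_entry (embed_op n T V) Z Y) = of_bool (X = Y)"
    if X: "X \<in> Pow {..<n}" and Y: "Y \<in> Pow {..<n}" for X Y
  proof -
    have "(\<Sum>Z\<in>Pow {..<n}. cnj (set_entry (embed_op n T V) Z X) * set_entry (embed_op n T V) Z Y)
      = (\<Sum>A\<in>Pow T. \<Sum>Z\<in>Pow ({..<n} - T). if Z = X - T then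
           (if X - T = Y - T then cnj (V $$ (?s A, ?s (X \<inter> T))) * V $$ (?s A, ?s (Y \<inter> T)) else 0) else 0)"
      unfolding sum_Pow_split[OF T]
    proof (intro sum.cong refl)
      fix A Z assume AZ: "A \<in> Pow T" "Z \<in> Pow ({..<n} - T)"
      then have eqs: "A \<union> Z - T = Z" "(A \<union> Z) \<inter> T = A" and "A \<union> Z \<subseteq> {..<n}"
        using T by blast+
      then have entry: "set_entry (embed_op n T V) (A \<union> Z) W = (if Z = W - T then V $$ (?s A, ?s (W \<inter> T)) else 0)"
        if "W \<in> Pow {..<n}" for W
        using embed_op_set_encode[OF T, of "A \<union> Z" W V] that unfolding set_entry_def eqs by simp
      show "cnj (set_entry (embed_op n T V) (A \<union> Z) X) * set_entry (embed_op n T V) (A \<union> Z) Y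
        = (if Z = X - T then
           (if X - T = Y - T then cnj (V $$ (?s A, ?s (X \<inter> T))) * V $$ (?s A, ?s (Y \<inter> T)) else 0) else 0)"
        unfolding entry[OF X] entry[OF Y] by simp
    qed
    also have "\<dots> = (\<Sum>A\<in>Pow T. if X - T = Y - T then cnj (V $$ (?s A, ?s (X \<inter> T))) * V $$ (?s A, ?s (Y \<inter> T)) else 0)"
      using X by (intro sum.cong refl) (subst sum.delta, auto)
    also have "\<dots> = (if X - T = Y - T then
        (\<Sum>A\<in>Pow T. cnj (V $$ (?s A, ?s (X \<inter> T))) * V $$ (?s A, ?s (Y \<inter> T))) else 0)"
      by simp
    also have "(\<Sum>A\<in>Pow T. cnj (V $$ (?s A, ?s (X \<inter> T))) * V $$ (?s A, ?s (Y \<inter> T)))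
      = (\<Sum>x<2 ^ card T. cnj (V $$ (x, ?s (X \<inter> T))) * V $$ (x, ?s (Y \<inter> T)))"
      by (rule sum.reindex_bij_betw[OF bij_betw_sub_index[OF fin]])
    also have "\<dots> = of_bool (X \<inter> T = Y \<inter> T)"
      using V s[of "X \<inter> T" "Y \<inter> T"] s[of "Y \<inter> T" "Y \<inter> T"] by (simp add: unitary_mat_iff)
    also have "(if X - T = Y - T then of_bool (X \<inter> T = Y \<inter> T) else 0) = (of_bool (X = Y) :: complex)"
    proof -
      have "X = Y \<longleftrightarrow> X - T = Y - T \<and> X \<inter> T = Y \<inter> T"
        by blast
      then show ?thesis
        by simp
    qed
    finally show ?thesis .
  qed
  then show ?thesis
    by (subst unitary_mat_set_entry) (simp_all add: embed_op_def)
qed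

text \<open>Up to a phase, the partial trace of a junta is its \<open>V\<close>, whose squared
  Frobenius norm is the full dimension.\<close>

lemma has_property_pauli_weight:
  assumes "has_property (juntas n k) U"
  shows "\<exists>T. T \<subseteq> {..<n} \<and> card T = k \<and>
    (\<Sum>a\<in>Pow T. \<Sum>b\<in>Pow T. (cmod (pauli_coeff n (set_entry U) a b))\<^sup>2) = 1"
proof -
  obtain \<theta> T V where T: "T \<subseteq> {..<n}" "card T = k" and V: "unitary_mat (2 ^ k) V"
    and U: "U = exp (\<i> * complex_of_real \<theta>) \<cdot>\<^sub>m embed_op n T V"
    using assms by (auto simp: has_property_def juntas_def)
  have fin: "finite T"
    using T finite_subset by blast
  let ?s = "\<lambda>X. sub_index T (set_encode X)"
  have pt: "cmod (partial_trace n T (set_entry U) X Y) = cmod (V $$ (?s X, ?s Y))" if "X \<in> Pow T" "Y \<in> Pow T" for X Y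
  proof -
    have "set_entry U (X \<union> Z) (Y \<union> Z) = exp (\<i> * complex_of_real \<theta>) * V $$ (?s X, ?s Y)"
      if Z: "Z \<in> Pow ({..<n} - T)" for Z
    proof -
      have "X \<union> Z \<subseteq> {..<n}" "Y \<union> Z \<subseteq> {..<n}" "X \<union> Z - T = Z" "Y \<union> Z - T = Z" "(X \<union> Z) \<inter> T = X" "(Y \<union> Z) \<inter> T = Y"
        using that Z T \<open>X \<in> Pow T\<close> \<open>Y \<in> Pow T\<close> by blast+
      then show ?thesis
        using embed_op_set_encode[OF T(1), of "X \<union> Z" "Y \<union> Z" V] set_encode_less[of "X \<union> Z" n] set_encode_less[of "Y \<union> Z" n]
        by (simp add: set_entry_def U embed_op_def)
    qed
    moreover have "card (Pow ({..<n} - T)) = 2 ^ (n - card T)"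
      using T fin by (simp add: card_Pow card_Diff_subset)
    ultimately have "partial_trace n T (set_entry U) X Y = exp (\<i> * complex_of_real \<theta>) * V $$ (?s X, ?s Y)"
      by (simp add: partial_trace_def)
    then show ?thesis
      by (simp add: norm_mult)
  qed
  have "(\<Sum>X\<in>Pow T. \<Sum>Y\<in>Pow T. (cmod (partial_trace n T (set_entry U) X Y))\<^sup>2)
     = (\<Sum>X\<in>Pow T. \<Sum>Y\<in>Pow T. (cmod (V $$ (?s X, ?s Y)))\<^sup>2)"
    by (intro sum.cong refl) (simp add: pt)
  also have "\<dots> = (\<Sum>X\<in>Pow T. \<Sum>y<2 ^ card T. (cmod (V $$ (?s X, y)))\<^sup>2)"
    by (intro sum.cong refl sum.reindex_bij_betw[OF bij_betw_sub_index[OF fin]])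
  also have "\<dots> = (\<Sum>x<2 ^ card T. \<Sum>y<2 ^ card T. (cmod (V $$ (x, y)))\<^sup>2)"
    by (rule sum.reindex_bij_betw[OF bij_betw_sub_index[OF fin]])
  also have "\<dots> = 2 ^ card T"
    using unitary_mat_frobenius[of "2 ^ card T" V] V T by simp
  finally show ?thesis
    using T by (auto simp: pauli_weight_partial_trace intro!: exI[of _ T])
qed

text \<open>The unitary aligned with the partial trace, embedded on \<open>T\<close>, is a junta
  whose normalized overlap with \<open>U\<close> is at least the weight inside \<open>T\<close>;
  farness bounds this overlap by 1 - \<epsilon>^2.\<close>

lemma pauli_weight_le_of_eps_far:
  assumes U: "unitary_mat (2 ^ n) U" and far: "eps_far (2 ^ n) (juntas n k) \<epsilon> U" and "\<epsilon> > 0"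
    and T: "T \<subseteq> {..<n}" "card T = k"
  shows "(\<Sum>a\<in>Pow T. \<Sum>b\<in>Pow T. (cmod (pauli_coeff n (set_entry U) a b))\<^sup>2) \<le> 1 - \<epsilon>\<^sup>2"
proof -
  let ?u = "set_entry U" and ?M = "partial_trace n T (set_entry U)" and ?R = "Pow ({..<n} - T)"
  have fin: "finite T"
    using T finite_subset by blast
  have "finite (Pow T)"
    using fin by simp
  then obtain W where W: "orthonormal_rows (Pow T) W"
    and le: "(\<Sum>X\<in>Pow T. \<Sum>Y\<in>Pow T. (cmod (?M X Y))\<^sup>2) \<le> Re (\<Sum>X\<in>Pow T. \<Sum>Y\<in>Pow T. cnj (W X Y) * ?M X Y)"
    using contraction_aligned_unitary[of "Pow T" ?M]
      partial_trace_contraction[OF T(1) unitary_set_entry_isometry[OF U]] by blast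
  let ?s = "\<lambda>X. sub_index T (set_encode X)"
  \<comment> \<open>\<open>W\<close> is indexed by subsets of \<open>T\<close> and a junta needs a
    numbered matrix, so the numbering is inverted.\<close>
  define r where "r = inv_into (Pow T) ?s"
  have bij: "bij_betw ?s (Pow T) {..<2 ^ k}"
    using bij_betw_sub_index[OF fin] T by simp
  have r: "bij_betw r {..<2 ^ k} (Pow T)"
    unfolding r_def by (rule bij_betw_inv_into[OF bij])
  have rs: "r (?s X) = X" if "X \<subseteq> T" for X
    unfolding r_def using bij_betw_inv_into_left[OF bij] that by blast
  have s_less: "?s X < 2 ^ k" if "X \<subseteq> T" for X
    using bij_betw_apply[OF bij] that by blast
  define V where "V = mat (2 ^ k) (2 ^ k) (\<lambda>(i,j). W (r i) (r j))"
  have V: "unitary_mat (2 ^ k) V"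
  proof (rule unitary_mat_of_rows)
    fix i j :: nat assume ij: "i < 2 ^ k" "j < 2 ^ k"
    then have "(\<Sum>x<2 ^ k. V $$ (i,x) * cnj (V $$ (j,x))) = (\<Sum>x<2 ^ k. W (r i) (r x) * cnj (W (r j) (r x)))"
      by (simp add: V_def)
    also have "\<dots> = (\<Sum>X\<in>Pow T. W (r i) X * cnj (W (r j) X))"
      by (rule sum.reindex_bij_betw[OF r])
    also have "\<dots> = of_bool (r i = r j)"
      using W bij_betw_apply[OF r] ij by (simp add: orthonormal_rows_def)
    also have "r i = r j \<longleftrightarrow> i = j"
      using r ij by (auto simp: bij_betw_def inj_on_def)
    finally show "(\<Sum>x<2 ^ k. V $$ (i,x) * cnj (V $$ (j,x))) = of_bool (i = j)" .
  qed (simp add: V_def)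
  let ?J = "embed_op n T V"
  have "?J \<in> juntas n k"
    using V T by (auto simp: juntas_def)
  have J: "unitary_mat (2 ^ n) ?J"
    using unitary_embed_op[of T n V] T V by simp
  \<comment> \<open>The junta is block diagonal over the complement of \<open>T\<close>. Only blocks
    with \<open>Z = Z'\<close> survive in its overlap with \<open>U\<close>, and they add up to an
    unnormalized partial trace.\<close>
  define z where "z = (\<Sum>i<2 ^ n. \<Sum>j<2 ^ n. cnj (?J $$ (i,j)) * U $$ (i,j))"
  have "z = (\<Sum>X\<in>Pow {..<n}. \<Sum>Y\<in>Pow {..<n}. cnj (set_entry ?J X Y) * ?u X Y)"
    unfolding z_def sum_set_encode set_entry_def ..
  also have "\<dots> = (\<Sum>X\<in>Pow T. \<Sum>Z\<in>?R. \<Sum>Y\<in>Pow T. \<Sum>Z'\<in>?R. cnj (set_entry ?J (X \<union> Z) (Y \<union> Z')) * ?u (X \<union> Z) (Y \<union> Z'))"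
    unfolding sum_Pow_split[OF T(1)] ..
  also have "\<dots> = (\<Sum>X\<in>Pow T. \<Sum>Z\<in>?R. \<Sum>Y\<in>Pow T. \<Sum>Z'\<in>?R. if Z = Z' then cnj (W X Y) * ?u (X \<union> Z) (Y \<union> Z') else 0)"
  proof (intro sum.cong refl)
    fix X Z Y Z' assume *: "X \<in> Pow T" "Z \<in> ?R" "Y \<in> Pow T" "Z' \<in> ?R"
    then have sub: "X \<union> Z \<subseteq> {..<n}" "Y \<union> Z' \<subseteq> {..<n}"
      and eqs: "X \<union> Z - T = Z" "Y \<union> Z' - T = Z'" "(X \<union> Z) \<inter> T = X" "(Y \<union> Z') \<inter> T = Y"
      using T by blast+
    have "V $$ (?s X, ?s Y) = W X Y"
      using * by (simp add: V_def s_less rs)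
    then have "set_entry ?J (X \<union> Z) (Y \<union> Z') = (if Z = Z' then W X Y else 0)"
      unfolding set_entry_def embed_op_set_encode[OF T(1) sub] eqs by simp
    then show "cnj (set_entry ?J (X \<union> Z) (Y \<union> Z')) * ?u (X \<union> Z) (Y \<union> Z')
      = (if Z = Z' then cnj (W X Y) * ?u (X \<union> Z) (Y \<union> Z') else 0)"
      by simp
  qed
  also have "\<dots> = (\<Sum>X\<in>Pow T. \<Sum>Z\<in>?R. \<Sum>Y\<in>Pow T. cnj (W X Y) * ?u (X \<union> Z) (Y \<union> Z))"
    by (intro sum.cong refl) simp
  also have "\<dots> = (\<Sum>X\<in>Pow T. \<Sum>Y\<in>Pow T. \<Sum>Z\<in>?R. cnj (W X Y) * ?u (X \<union> Z) (Y \<union> Z))"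
    by (rule sum.cong[OF refl sum.swap])
  also have "\<dots> = 2 ^ (n - k) * (\<Sum>X\<in>Pow T. \<Sum>Y\<in>Pow T. cnj (W X Y) * ?M X Y)"
    unfolding partial_trace_def T(2) sum_distrib_left[of "2 ^ (n - k)" _ "Pow T"]
    by (intro sum.cong refl) (simp flip: sum_distrib_left)
  finally have z: "z = of_real (2 ^ (n - k)) * (\<Sum>X\<in>Pow T. \<Sum>Y\<in>Pow T. cnj (W X Y) * ?M X Y)"
    by simp
  define m where "m = (\<Sum>X\<in>Pow T. \<Sum>Y\<in>Pow T. (cmod (?M X Y))\<^sup>2)"
  have "2 ^ (n - k) * m \<le> Re z"
    unfolding z Re_complex_of_real using le by (simp add: m_def)
  also have "\<dots> \<le> cmod z"
    by (rule complex_Re_le_cmod)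
  finally have "2 ^ (n - k) * m / 2 ^ n \<le> cmod z / 2 ^ n"
    by (simp add: divide_right_mono)
  moreover have "k \<le> n"
    using T card_mono[OF _ T(1)] by simp
  ultimately have mz: "m / 2 ^ k \<le> cmod z / 2 ^ n"
    by (simp add: power_diff)
  have "\<epsilon> \<le> dist_ph (2 ^ n) U ?J"
    using far \<open>?J \<in> juntas n k\<close> by (simp add: eps_far_def)
  also have "\<dots> \<le> sqrt (1 - cmod z / 2 ^ n)"
    using dist_ph_le[OF U J] by (simp add: z_def)
  finally have "\<epsilon> \<le> sqrt (1 - cmod z / 2 ^ n)" .
  \<comment> \<open>\<open>sqrt\<close> is negative on negative arguments, so \<epsilon> > 0 forces
    a positive argument and squaring is legitimate.\<close>
  moreover from this have "1 - cmod z / 2 ^ n > 0"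
    using \<open>\<epsilon> > 0\<close> by (metis less_le_trans real_sqrt_gt_0_iff)
  ultimately have "\<epsilon>\<^sup>2 \<le> 1 - cmod z / 2 ^ n"
    using \<open>\<epsilon> > 0\<close> by (metis less_imp_le power_mono real_sqrt_pow2)
  then show ?thesis
    using mz T by (simp add: pauli_weight_partial_trace m_def)
qed

section \<open>Sequential composition of query algorithms\<close>

abbreviation vec_inner :: "nat \<Rightarrow> complex vec \<Rightarrow> complex vec \<Rightarrow> complex" where
  "vec_inner D v w \<equiv> inner_on {..<D} (\<lambda>i. v $ i) (\<lambda>i. w $ i)"

lemma mult_mat_vec_nth:
  assumes "A \<in> carrier_mat D D" "v \<in> carrier_vec D" "i < D"
  shows "(A *\<^sub>v v) $ i = (\<Sum>j<D. A $$ (i,j) * v $ j)"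
  using assms by (auto simp: scalar_prod_def atLeast0LessThan intro!: sum.cong)

lemma vec_inner_unitary:
  assumes W: "unitary_mat D W" and "v \<in> carrier_vec D" "w \<in> carrier_vec D"
  shows "vec_inner D (W *\<^sub>v v) (W *\<^sub>v w) = vec_inner D v w"
proof -
  let ?S = "{..<D}" and ?W = "\<lambda>i j. W $$ (i,j)"
  have W': "W \<in> carrier_mat D D"
    using W by (simp add: unitary_mat_def)
  have "vec_inner D (W *\<^sub>v v) (W *\<^sub>v w) = inner_on ?S (app_on ?S ?W (\<lambda>i. v $ i)) (app_on ?S ?W (\<lambda>i. w $ i))"
    unfolding inner_on_def app_on_def
    by (intro sum.cong refl arg_cong2[where f="(*)"] arg_cong[where f=cnj])
      (rule mult_mat_vec_nth[OF W'], use assms in auto)+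
  also have "\<dots> = inner_on ?S (\<lambda>i. v $ i) (app_on ?S (\<lambda>j l. \<Sum>i\<in>?S. cnj (W $$ (i,j)) * W $$ (i,l)) (\<lambda>i. w $ i))"
    by (rule inner_on_adjoint[symmetric])
  also have "\<dots> = vec_inner D v w"
    unfolding inner_on_def app_on_def
  proof (intro sum.cong refl arg_cong2[where f="(*)"])
    fix j assume j: "j \<in> ?S"
    have "(\<Sum>l\<in>?S. (\<Sum>i\<in>?S. cnj (W $$ (i,j)) * W $$ (i,l)) * w $ l) = (\<Sum>l\<in>?S. if j = l then w $ l else 0)"
      using W j by (intro sum.cong refl) (auto simp: unitary_mat_iff)
    then show "(\<Sum>l\<in>?S. (\<Sum>i\<in>?S. cnj (W $$ (i,j)) * W $$ (i,l)) * w $ l) = w $ j"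
      using j by simp
  qed
  finally show ?thesis .
qed

lemma adj_mult:
  assumes "A \<in> carrier_mat m n" "B \<in> carrier_mat n p"
  shows "adj (A * B) = adj B * adj A"
proof (rule eq_matI)
  fix i j assume "i < dim_row (adj B * adj A)" "j < dim_col (adj B * adj A)"
  then show "adj (A * B) $$ (i,j) = (adj B * adj A) $$ (i,j)"
    using assms by (auto simp: scalar_prod_def mult.commute intro!: sum.cong)
qed (use assms in auto)

lemma unitary_mat_mult:
  assumes A: "unitary_mat D A" and B: "unitary_mat D B"
  shows "unitary_mat D (A * B)"
proof -
  have AB: "A \<in> carrier_mat D D" "B \<in> carrier_mat D D"
    using A B by (auto simp: unitary_mat_def)
  then have [simp]: "adj A \<in> carrier_mat D D" "adj B \<in> carrier_mat D D"
    by simp_all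
  have "adj (A * B) * (A * B) = adj B * (adj A * (A * B))"
    using AB by (simp add: adj_mult assoc_mult_mat[of _ D D _ D _ D])
  also have "adj A * (A * B) = (adj A * A) * B"
    using AB by (simp add: assoc_mult_mat[of _ D D _ D _ D])
  also have "adj B * ((adj A * A) * B) = 1\<^sub>m D"
    using A B AB by (simp add: unitary_mat_def)
  finally show ?thesis
    using AB by (simp add: unitary_mat_def)
qed

lemma unitary_mat_one: "unitary_mat D (1\<^sub>m D)"
  by (auto simp: unitary_mat_iff of_bool_def if_distrib[where f=cnj] if_distrib[where f="\<lambda>c. c * _"] cong: if_cong)

text \<open>A complex Householder map: the identity minus u<u,.>/\<alpha>, with u = v - w and
  \<alpha> = <u,v>. As |u|^2 = \<alpha> + \<open>cnj \<alpha>\<close>, it is unitary even for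
  non-real \<alpha>, and \<alpha> = 0 happens only for v = w.\<close>

lemma unitary_reflection:
  assumes v: "v \<in> carrier_vec D" and w: "w \<in> carrier_vec D"
    and vv: "vec_inner D v v = 1" and ww: "vec_inner D w w = 1"
  shows "\<exists>R. unitary_mat D R \<and> R *\<^sub>v v = w \<and>
     (\<forall>x\<in>carrier_vec D. vec_inner D v x = 0 \<longrightarrow> vec_inner D w x = 0 \<longrightarrow> R *\<^sub>v x = x)"
proof -
  define u where "u = (\<lambda>i. v $ i - w $ i)"
  define \<alpha> where "\<alpha> = inner_on {..<D} u (\<lambda>i. v $ i)"
  have inner_u: "inner_on {..<D} u x = inner_on {..<D} (\<lambda>i. v $ i) x - inner_on {..<D} (\<lambda>i. w $ i) x" for x
    by (simp add: inner_on_def u_def left_diff_distrib sum_subtractf)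
  have wv: "vec_inner D v w = cnj (vec_inner D w v)"
    by (simp add: inner_on_def mult.commute)
  have \<alpha>: "\<alpha> = 1 - vec_inner D w v"
    by (simp add: \<alpha>_def inner_u vv)
  have "inner_on {..<D} u u = inner_on {..<D} u (\<lambda>i. v $ i) - inner_on {..<D} u (\<lambda>i. w $ i)"
    by (simp add: inner_on_def u_def right_diff_distrib sum_subtractf)
  also have "\<dots> = \<alpha> + cnj \<alpha>"
    by (simp add: inner_u \<alpha> vv ww wv)
  finally have uu: "inner_on {..<D} u u = \<alpha> + cnj \<alpha>" .
  show ?thesis
  proof (cases "\<alpha> = 0")
    case True
    then have "complex_of_real (\<Sum>j<D. (cmod (u j))\<^sup>2) = 0"
      using uu unfolding inner_on_self by simp
    then have "(\<Sum>j<D. (cmod (u j))\<^sup>2) = 0"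
      using of_real_eq_0_iff by blast
    then have "u j = 0" if "j < D" for j
      using that by (simp add: sum_nonneg_eq_0_iff)
    then have "v = w"
      using v w by (intro eq_vecI) (auto simp: u_def)
    then show ?thesis
      using v unitary_mat_one by (intro exI[of _ "1\<^sub>m D"]) auto
  next
    case False
    define R where "R = mat D D (\<lambda>(i,j). of_bool (i = j) - u i * cnj (u j) / \<alpha>)"
    have R: "R \<in> carrier_mat D D"
      by (simp add: R_def)
    have "unitary_mat D R"
      unfolding unitary_mat_iff
    proof (intro conjI allI impI R)
      fix i j assume ij: "i < D" "j < D"
      have "(\<Sum>x<D. cnj (R $$ (x,i)) * R $$ (x,j))
        = (\<Sum>x<D. (if x = i then of_bool (i = j) else 0) - (if x = i then u i * cnj (u j) / \<alpha> else 0)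
          - (if x = j then cnj (u j) * u i / cnj \<alpha> else 0)
          + cnj (u x) * u x * (u i * cnj (u j) / (\<alpha> * cnj \<alpha>)))"
        using ij False by (intro sum.cong refl) (simp add: R_def algebra_simps)
      also have "\<dots> = of_bool (i = j) - u i * cnj (u j) / \<alpha> - cnj (u j) * u i / cnj \<alpha>
          + inner_on {..<D} u u * u i * cnj (u j) / (\<alpha> * cnj \<alpha>)"
        using ij by (simp add: inner_on_def sum.distrib sum_subtractf sum_distrib_right sum_divide_distrib mult.assoc)
      also have "of_bool (i = j) - u i * cnj (u j) / \<alpha> - cnj (u j) * u i / cnj \<alpha>
          + inner_on {..<D} u u * u i * cnj (u j) / (\<alpha> * cnj \<alpha>) = of_bool (i = j)"
        unfolding uu using False by (simp add: field_simps)
      finally show "(\<Sum>x<D. cnj (R $$ (x,i)) * R $$ (x,j)) = of_bool (i = j)" .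
    qed
    moreover have app: "(R *\<^sub>v x) $ i = x $ i - u i * inner_on {..<D} u (\<lambda>i. x $ i) / \<alpha>"
      if "x \<in> carrier_vec D" "i < D" for x i
    proof -
      have "(R *\<^sub>v x) $ i = (\<Sum>j<D. (if i = j then x $ j else 0) - u i * (cnj (u j) * x $ j) / \<alpha>)"
        unfolding mult_mat_vec_nth[OF R that] using that
        by (intro sum.cong refl) (simp add: R_def algebra_simps)
      also have "\<dots> = x $ i - u i * inner_on {..<D} u (\<lambda>i. x $ i) / \<alpha>"
        using that by (simp add: inner_on_def sum_subtractf sum_distrib_left sum_divide_distrib)
      finally show ?thesis .
    qed
    have "R *\<^sub>v v = w"
    proof (rule eq_vecI)
      fix i assume "i < dim_vec w"
      then show "(R *\<^sub>v v) $ i = w $ i"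
        using app[OF v, of i, folded \<alpha>_def] w False by (simp add: u_def)
    qed (use R w in auto)
    moreover have "R *\<^sub>v x = x" if "x \<in> carrier_vec D" "vec_inner D v x = 0" "vec_inner D w x = 0" for x
    proof (rule eq_vecI)
      fix i assume "i < dim_vec x"
      then show "(R *\<^sub>v x) $ i = x $ i"
        using app[of x i] that by (simp add: inner_u)
    qed (use R that in auto)
    ultimately show ?thesis
      by blast
  qed
qed

text \<open>By induction: once the first \<open>m\<close> vectors are placed, a reflection moves the
  image of \<open>v m\<close> to \<open>w m\<close>. It fixes the earlier \<open>w i\<close>, which
  are orthogonal to both.\<close>

lemma unitary_mapping_orthonormal:
  fixes m :: nat
  assumes "\<And>i. i < m \<Longrightarrow> v i \<in> carrier_vec D" "\<And>i. i < m \<Longrightarrow> w i \<in> carrier_vec D"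
    and "\<And>i j. i < m \<Longrightarrow> j < m \<Longrightarrow> vec_inner D (v i) (v j) = of_bool (i = j)"
    and "\<And>i j. i < m \<Longrightarrow> j < m \<Longrightarrow> vec_inner D (w i) (w j) = of_bool (i = j)"
  shows "\<exists>W. unitary_mat D W \<and> (\<forall>i<m. W *\<^sub>v v i = w i)"
  using assms
proof (induction m)
  case 0
  then show ?case
    using unitary_mat_one by blast
next
  case (Suc m)
  have "\<exists>W. unitary_mat D W \<and> (\<forall>i<m. W *\<^sub>v v i = w i)"
    by (rule Suc.IH) (use Suc.prems in auto)
  then obtain W where W: "unitary_mat D W" and Wv: "\<And>i. i < m \<Longrightarrow> W *\<^sub>v v i = w i"
    by blast
  have WD: "W \<in> carrier_mat D D"
    using W by (simp add: unitary_mat_def)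
  have carr: "v i \<in> carrier_vec D" "w i \<in> carrier_vec D" if "i \<le> m" for i
    using Suc.prems(1,2) that by simp_all
  have Wm: "W *\<^sub>v v m \<in> carrier_vec D"
    using WD carr[of m] by simp
  have "vec_inner D (W *\<^sub>v v m) (W *\<^sub>v v m) = 1"
    unfolding vec_inner_unitary[OF W carr(1)[OF order_refl] carr(1)[OF order_refl]] using Suc.prems(3)[of m m] by simp
  then obtain R where R: "unitary_mat D R" "R *\<^sub>v (W *\<^sub>v v m) = w m"
    and Rx: "\<And>x. x \<in> carrier_vec D \<Longrightarrow> vec_inner D (W *\<^sub>v v m) x = 0 \<Longrightarrow> vec_inner D (w m) x = 0 \<Longrightarrow> R *\<^sub>v x = x"
    using unitary_reflection[OF Wm carr(2)[OF order_refl]] Suc.prems(4)[of m m] by auto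
  have RD: "R \<in> carrier_mat D D"
    using R by (simp add: unitary_mat_def)
  have "(R * W) *\<^sub>v v i = w i" if i: "i < Suc m" for i
  proof (cases "i = m")
    case True
    then show ?thesis
      using R(2) assoc_mult_mat_vec[OF RD WD carr(1)] by simp
  next
    case False
    then have im: "i < m"
      using i by simp
    have "vec_inner D (W *\<^sub>v v m) (W *\<^sub>v v i) = 0"
      using vec_inner_unitary[OF W carr(1) carr(1), of m i] Suc.prems(3)[of m i] im by simp
    then have "R *\<^sub>v w i = w i"
      using Rx[of "w i"] carr(2)[of i] Wv[OF im] Suc.prems(4)[of m i] im by simp
    then show ?thesis
      using assoc_mult_mat_vec[OF RD WD carr(1)[of i]] Wv[OF im] im by simp
  qed
  then show ?case
    using unitary_mat_mult[OF R(1) W] by blast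
qed

section \<open>Block operators controlled by a register\<close>

lemma sum_div_mod:
  fixes g :: "nat \<Rightarrow> nat \<Rightarrow> 'a::comm_monoid_add"
  assumes "m > 0"
  shows "(\<Sum>t<D * m. g (t div m) (t mod m)) = (\<Sum>x<D. \<Sum>i<m. g x i)"
proof -
  have "bij_betw (\<lambda>t. (t div m, t mod m)) {..<D * m} ({..<D} \<times> {..<m})"
  proof (rule bij_betw_byWitness[where f'="\<lambda>(x,i). x * m + i"])
    show "(\<lambda>(x,i). x * m + i) ` ({..<D} \<times> {..<m}) \<subseteq> {..<D * m}"
    proof clarsimp
      fix x i assume xi: "x < D" "i < m"
      then have "x * m + i < Suc x * m"
        by simp
      also have "\<dots> \<le> D * m"
        using xi by (intro mult_le_mono1) simp
      finally show "x * m + i < D * m" .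
    qed
  qed (use assms in \<open>auto simp: less_mult_imp_div_less\<close>)
  from sum.reindex_bij_betw[OF this, of "\<lambda>(x,i). g x i"] show ?thesis
    by (simp add: sum.cartesian_product)
qed

text \<open>Vectors and block-diagonal operators on \<open>\<complex>\<^sup>D \<otimes> \<complex>\<^sup>m\<close>, where the second factor is a classical
  register that selects the block; the basis vector \<open>|x\<rangle>|i\<rangle>\<close> has index \<open>x * m + i\<close>.\<close>

definition block_vec :: "nat \<Rightarrow> nat \<Rightarrow> (nat \<Rightarrow> complex vec) \<Rightarrow> complex vec" where
  "block_vec D m f = vec (D * m) (\<lambda>t. f (t mod m) $ (t div m))"

definition block_mat :: "nat \<Rightarrow> nat \<Rightarrow> (nat \<Rightarrow> complex mat) \<Rightarrow> complex mat" where
  "block_mat D m F = mat (D * m) (D * m)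
     (\<lambda>(s,t). if s mod m = t mod m then F (s mod m) $$ (s div m, t div m) else 0)"

lemma block_vec_carrier [simp]: "block_vec D m f \<in> carrier_vec (D * m)"
  by (simp add: block_vec_def)

lemma block_mat_carrier [simp]: "block_mat D m F \<in> carrier_mat (D * m) (D * m)"
  by (simp add: block_mat_def)

lemma block_index:
  assumes "(t::nat) < D * m"
  shows "t mod m < m" "t div m < D"
proof -
  have "m > 0"
    using assms by (cases m) auto
  then show "t mod m < m" "t div m < D"
    using assms by (simp_all add: less_mult_imp_div_less)
qed

lemma block_vec_cong:
  assumes "\<And>i. i < m \<Longrightarrow> f i = g i"
  shows "block_vec D m f = block_vec D m g"
  unfolding block_vec_def using assms block_index(1)[of _ D m] by (intro eq_vecI) auto

lemma block_mat_cong: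
  assumes "\<And>i. i < m \<Longrightarrow> F i = G i"
  shows "block_mat D m F = block_mat D m G"
  unfolding block_mat_def using assms block_index(1)[of _ D m] by (intro eq_matI) auto

lemma block_mat_mult_vec:
  assumes m: "m > 0" and F: "\<And>i. i < m \<Longrightarrow> F i \<in> carrier_mat D D" and f: "\<And>i. i < m \<Longrightarrow> f i \<in> carrier_vec D"
  shows "block_mat D m F *\<^sub>v block_vec D m f = block_vec D m (\<lambda>i. F i *\<^sub>v f i)"
proof (rule eq_vecI)
  fix s assume "s < dim_vec (block_vec D m (\<lambda>i. F i *\<^sub>v f i))"
  then have s: "s < D * m"
    by (simp add: block_vec_def)
  have "(block_mat D m F *\<^sub>v block_vec D m f) $ s
    = (\<Sum>t<D * m. (\<lambda>x i. if s mod m = i then F i $$ (s div m, x) * f i $ x else 0) (t div m) (t mod m))"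
    unfolding mult_mat_vec_nth[OF block_mat_carrier block_vec_carrier s]
    using s by (intro sum.cong refl) (simp add: block_mat_def block_vec_def)
  also have "\<dots> = (\<Sum>x<D. \<Sum>i<m. if s mod m = i then F i $$ (s div m, x) * f i $ x else 0)"
    by (rule sum_div_mod[OF m])
  also have "\<dots> = (\<Sum>x<D. F (s mod m) $$ (s div m, x) * f (s mod m) $ x)"
    using m by simp
  also have "\<dots> = block_vec D m (\<lambda>i. F i *\<^sub>v f i) $ s"
    using mult_mat_vec_nth[OF F f, of "s mod m" "s mod m"] block_index[OF s] s by (simp add: block_vec_def)
  finally show "(block_mat D m F *\<^sub>v block_vec D m f) $ s = block_vec D m (\<lambda>i. F i *\<^sub>v f i) $ s" .
qed (simp add: block_vec_def block_mat_def)

lemma block_mat_mult: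
  assumes m: "m > 0" and F: "\<And>i. i < m \<Longrightarrow> F i \<in> carrier_mat D D" and G: "\<And>i. i < m \<Longrightarrow> G i \<in> carrier_mat D D"
  shows "block_mat D m F * block_mat D m G = block_mat D m (\<lambda>i. F i * G i)"
proof (rule eq_matI)
  fix s r assume "s < dim_row (block_mat D m (\<lambda>i. F i * G i))" "r < dim_col (block_mat D m (\<lambda>i. F i * G i))"
  then have sr: "s < D * m" "r < D * m"
    by (simp_all add: block_mat_def)
  have "(block_mat D m F * block_mat D m G) $$ (s,r) = (\<Sum>t<D * m. block_mat D m F $$ (s,t) * block_mat D m G $$ (t,r))"
    using sr by (auto simp: block_mat_def scalar_prod_def atLeast0LessThan intro!: sum.cong)
  also have "\<dots> = (\<Sum>t<D * m. (\<lambda>x i. if s mod m = i then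
       (if i = r mod m then F i $$ (s div m, x) * G i $$ (x, r div m) else 0) else 0) (t div m) (t mod m))"
    using sr by (intro sum.cong refl) (simp add: block_mat_def)
  also have "\<dots> = (\<Sum>x<D. \<Sum>i<m. if s mod m = i then
       (if i = r mod m then F i $$ (s div m, x) * G i $$ (x, r div m) else 0) else 0)"
    by (rule sum_div_mod[OF m])
  also have "\<dots> = (\<Sum>x<D. if s mod m = r mod m then F (s mod m) $$ (s div m, x) * G (s mod m) $$ (x, r div m) else 0)"
    using m by simp
  also have "\<dots> = (if s mod m = r mod m then (\<Sum>x<D. F (s mod m) $$ (s div m, x) * G (s mod m) $$ (x, r div m)) else 0)"
    by simp
  also have "(\<Sum>x<D. F (s mod m) $$ (s div m, x) * G (s mod m) $$ (x, r div m)) = (F (s mod m) * G (s mod m)) $$ (s div m, r div m)"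
    using F[of "s mod m"] G[of "s mod m"] block_index[OF sr(1)] block_index[OF sr(2)]
    by (auto simp: scalar_prod_def atLeast0LessThan intro!: sum.cong)
  finally show "(block_mat D m F * block_mat D m G) $$ (s,r) = block_mat D m (\<lambda>i. F i * G i) $$ (s,r)"
    using sr by (simp add: block_mat_def)
qed (simp_all add: block_mat_def)

lemma adj_block_mat:
  assumes "\<And>i. i < m \<Longrightarrow> F i \<in> carrier_mat D D"
  shows "adj (block_mat D m F) = block_mat D m (\<lambda>i. adj (F i))"
proof (rule eq_matI)
  fix s r assume "s < dim_row (block_mat D m (\<lambda>i. adj (F i)))" "r < dim_col (block_mat D m (\<lambda>i. adj (F i)))"
  then have sr: "s < D * m" "r < D * m"
    by (simp_all add: block_mat_def)
  then show "adj (block_mat D m F) $$ (s,r) = block_mat D m (\<lambda>i. adj (F i)) $$ (s,r)"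
    using assms[of "s mod m"] block_index[OF sr(1)] block_index[OF sr(2)] by (auto simp: block_mat_def)
qed (simp_all add: block_mat_def)

lemma block_mat_one: "block_mat D m (\<lambda>_. 1\<^sub>m D) = 1\<^sub>m (D * m)"
proof (rule eq_matI)
  fix s r assume "s < dim_row (1\<^sub>m (D * m) :: complex mat)" "r < dim_col (1\<^sub>m (D * m) :: complex mat)"
  then have sr: "s < D * m" "r < D * m"
    by simp_all
  have "s = r \<longleftrightarrow> s mod m = r mod m \<and> s div m = r div m"
    by (metis div_mult_mod_eq)
  then show "block_mat D m (\<lambda>_. 1\<^sub>m D) $$ (s,r) = 1\<^sub>m (D * m) $$ (s,r)"
    using sr block_index[OF sr(1)] block_index[OF sr(2)] by (simp add: block_mat_def)
qed (simp_all add: block_mat_def)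

lemma unitary_block_mat:
  assumes "m > 0" "\<And>i. i < m \<Longrightarrow> unitary_mat D (F i)"
  shows "unitary_mat (D * m) (block_mat D m F)"
proof -
  have F: "F i \<in> carrier_mat D D" if "i < m" for i
    using assms that by (simp add: unitary_mat_def)
  have "adj (block_mat D m F) * block_mat D m F = block_mat D m (\<lambda>i. adj (F i) * F i)"
    using F assms by (simp add: adj_block_mat block_mat_mult)
  also have "\<dots> = block_mat D m (\<lambda>_. 1\<^sub>m D)"
    using assms by (intro block_mat_cong) (simp add: unitary_mat_def)
  finally show ?thesis
    by (simp add: unitary_mat_def block_mat_one)
qed

text \<open>The register is the least significant part of the enlarged ancilla, so a query acts in
  every block as the same query with ancilla dimension \<open>d\<close>.\<close>

lemma kron_id_block_mat:
  assumes U: "U \<in> carrier_mat N N"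
  shows "kron_id (d * m) U = block_mat (N * d) m (\<lambda>_. kron_id d U)"
proof (rule eq_matI)
  fix s r assume "s < dim_row (block_mat (N * d) m (\<lambda>_. kron_id d U))" "r < dim_col (block_mat (N * d) m (\<lambda>_. kron_id d U))"
  then have sr: "s < N * d * m" "r < N * d * m"
    by (simp_all add: block_mat_def)
  have m: "m > 0"
    using sr by (cases m) auto
  have "s mod (m * d) = r mod (m * d) \<longleftrightarrow> s mod m = r mod m \<and> s div m mod d = r div m mod d"
  proof
    assume "s mod (m * d) = r mod (m * d)"
    then have "s mod (m * d) mod m = r mod (m * d) mod m" "s mod (m * d) div m = r mod (m * d) div m"
      by simp_all
    then show "s mod m = r mod m \<and> s div m mod d = r div m mod d"
      using m by (simp add: mod_mult2_eq)
  qed (simp add: mod_mult2_eq)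
  then show "kron_id (d * m) U $$ (s,r) = block_mat (N * d) m (\<lambda>_. kron_id d U) $$ (s,r)"
    using U sr block_index[OF sr(1)] block_index[OF sr(2)]
    by (auto simp: block_mat_def kron_id_def div_mult2_eq mult.commute[of d m] mult.assoc)
qed (use U in \<open>simp_all add: block_mat_def kron_id_def mult.assoc\<close>)

lemma vec_inner_block_vec:
  assumes m: "m > 0"
  shows "vec_inner (D * m) (block_vec D m f) (block_vec D m g) = (\<Sum>i<m. vec_inner D (f i) (g i))"
proof -
  have "vec_inner (D * m) (block_vec D m f) (block_vec D m g)
     = (\<Sum>t<D * m. (\<lambda>x i. cnj (f i $ x) * g i $ x) (t div m) (t mod m))"
    unfolding inner_on_def by (intro sum.cong refl) (simp add: block_vec_def)
  also have "\<dots> = (\<Sum>x<D. \<Sum>i<m. cnj (f i $ x) * g i $ x)"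
    by (rule sum_div_mod[OF m])
  also have "\<dots> = (\<Sum>i<m. vec_inner D (f i) (g i))"
    unfolding inner_on_def by (rule sum.swap)
  finally show ?thesis .
qed

lemma vec_inner_self: "v \<in> carrier_vec D \<Longrightarrow> vec_inner D v v = of_real (vnorm_sq v)"
  by (auto simp: inner_on_self vnorm_sq_def)

lemma vnorm_sq_block_vec:
  assumes "m > 0" "\<And>i. i < m \<Longrightarrow> f i \<in> carrier_vec D"
  shows "vnorm_sq (block_vec D m f) = (\<Sum>i<m. vnorm_sq (f i))"
proof -
  have "complex_of_real (vnorm_sq (block_vec D m f)) = complex_of_real (\<Sum>i<m. vnorm_sq (f i))"
    using vec_inner_block_vec[OF assms(1), of D f f] assms(2)
    by (simp add: vec_inner_self)
  then show ?thesis
    using of_real_eq_iff by blast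
qed

lemma vnorm_sq_smult: "vnorm_sq (c \<cdot>\<^sub>v v) = (cmod c)\<^sup>2 * vnorm_sq v"
  by (simp add: vnorm_sq_def norm_mult power_mult_distrib sum_distrib_left)

lemma kron_id_carrier: "U \<in> carrier_mat N N \<Longrightarrow> kron_id d U \<in> carrier_mat (N * d) (N * d)"
  by (simp add: kron_id_def)

section \<open>Running query algorithms in superposed branches\<close>

lemma fold_query_carrier:
  assumes "K \<in> carrier_mat D D" "\<And>W. W \<in> set Ws \<Longrightarrow> W \<in> carrier_mat D D" "s \<in> carrier_vec D"
  shows "fold (\<lambda>W s. W *\<^sub>v (K *\<^sub>v s)) Ws s \<in> carrier_vec D"
  using assms(2,3)
proof (induction Ws arbitrary: s)
  case (Cons W Ws)
  then show ?case
    using assms(1) by (simp add: mult_mat_vec_carrier[of _ D D])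
qed simp

lemma fold_query_smult:
  fixes K :: "complex mat"
  assumes "K \<in> carrier_mat D D" "\<And>W. W \<in> set Ws \<Longrightarrow> W \<in> carrier_mat D D" "s \<in> carrier_vec D"
  shows "fold (\<lambda>W s. W *\<^sub>v (K *\<^sub>v s)) Ws (c \<cdot>\<^sub>v s) = c \<cdot>\<^sub>v fold (\<lambda>W s. W *\<^sub>v (K *\<^sub>v s)) Ws s"
  using assms(2,3)
proof (induction Ws arbitrary: s)
  case (Cons W Ws)
  then have W: "W \<in> carrier_mat D D" and Ks: "K *\<^sub>v s \<in> carrier_vec D"
    using assms(1) by (simp_all add: mult_mat_vec_carrier[of _ D D])
  have "W *\<^sub>v (K *\<^sub>v (c \<cdot>\<^sub>v s)) = c \<cdot>\<^sub>v (W *\<^sub>v (K *\<^sub>v s))"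
    unfolding mult_mat_vec[OF assms(1) Cons.prems(2)] mult_mat_vec[OF W Ks] ..
  then show ?case
    using Cons W Ks by (simp add: mult_mat_vec_carrier[of _ D D])
qed simp

text \<open>Nothing mixes the blocks, so each branch runs by itself. The common length
  \<open>q\<close> lets the j-th operations of all branches form one block matrix.\<close>

lemma fold_query_block:
  assumes m: "m > 0" and K: "K \<in> carrier_mat D D"
    and Ws: "\<And>i W. i < m \<Longrightarrow> W \<in> set (Ws i) \<Longrightarrow> W \<in> carrier_mat D D"
    and len: "\<And>i. i < m \<Longrightarrow> length (Ws i) = q"
    and f: "\<And>i. i < m \<Longrightarrow> f i \<in> carrier_vec D"
  shows "fold (\<lambda>W s. W *\<^sub>v (block_mat D m (\<lambda>_. K) *\<^sub>v s)) (map (\<lambda>j. block_mat D m (\<lambda>i. Ws i ! j)) [0..<q]) (block_vec D m f)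
    = block_vec D m (\<lambda>i. fold (\<lambda>W s. W *\<^sub>v (K *\<^sub>v s)) (Ws i) (f i))"
proof -
  have "fold (\<lambda>W s. W *\<^sub>v (block_mat D m (\<lambda>_. K) *\<^sub>v s)) (map (\<lambda>j. block_mat D m (\<lambda>i. Ws i ! j)) [0..<p]) (block_vec D m f)
    = block_vec D m (\<lambda>i. fold (\<lambda>W s. W *\<^sub>v (K *\<^sub>v s)) (take p (Ws i)) (f i))" if "p \<le> q" for p
    using that
  proof (induction p)
    case (Suc p)
    let ?st = "\<lambda>i. fold (\<lambda>W s. W *\<^sub>v (K *\<^sub>v s)) (take p (Ws i)) (f i)"
    have st: "?st i \<in> carrier_vec D" if "i < m" for i
      by (rule fold_query_carrier[OF K]) (use that Ws f in \<open>auto dest: in_set_takeD\<close>)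
    have nth: "Ws i ! p \<in> carrier_mat D D" if "i < m" for i
      using Ws[OF that nth_mem] len[OF that] Suc.prems by simp
    have "fold (\<lambda>W s. W *\<^sub>v (block_mat D m (\<lambda>_. K) *\<^sub>v s)) (map (\<lambda>j. block_mat D m (\<lambda>i. Ws i ! j)) [0..<Suc p]) (block_vec D m f)
       = block_mat D m (\<lambda>i. Ws i ! p) *\<^sub>v (block_mat D m (\<lambda>_. K) *\<^sub>v block_vec D m ?st)"
      using Suc by simp
    also have "\<dots> = block_vec D m (\<lambda>i. Ws i ! p *\<^sub>v (K *\<^sub>v ?st i))"
      using m K st nth by (simp add: block_mat_mult_vec mult_mat_vec_carrier[of _ D D])
    also have "\<dots> = block_vec D m (\<lambda>i. fold (\<lambda>W s. W *\<^sub>v (K *\<^sub>v s)) (take (Suc p) (Ws i)) (f i))"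
      using len Suc.prems by (intro block_vec_cong) (simp add: take_Suc_conv_app_nth)
    finally show ?case .
  qed simp
  from this[of q] show ?thesis
    using len by (simp cong: block_vec_cong)
qed

text \<open>One query on half of a maximally entangled state, a measurement in the basis \<open>e\<close> of the
  operator space, and then the algorithm \<open>A i\<close> selected by the outcome \<open>i\<close>. The measurement is
  deferred: \<open>W\<close> coherently maps the \<open>i\<close>-th basis state to \<open>|i\<rangle>\<close> together with the initial state
  of \<open>A i\<close>.\<close>

lemma sequential_composition:
  assumes N: "N \<ge> 1" and d: "d \<ge> 1" and Nm: "N \<le> m"
    and e: "\<And>i j. i < m \<Longrightarrow> j < m \<Longrightarrow> (\<Sum>x<N. \<Sum>y<N. cnj (e i x y) * e j x y) = of_bool (i = j)"
    and A: "\<And>i. i < m \<Longrightarrow> valid_qalg N (A i) \<and> anc (A i) = d \<and> num_queries (A i) = q"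
  shows "\<exists>B. valid_qalg N B \<and> anc B = d * m \<and> num_queries B = Suc q \<and>
    (\<forall>U c. U \<in> carrier_mat N N \<longrightarrow>
       (\<forall>x<N. \<forall>y<N. U $$ (x,y) / sqrt (real N) = (\<Sum>i<m. c i * e i x y)) \<longrightarrow>
       accept_prob B U = (\<Sum>i<m. (cmod (c i))\<^sup>2 * accept_prob (A i) U))"
proof -
  define D where "D = N * d"
  have m: "m > 0"
    using N Nm by simp
  have Ainit: "init (A i) \<in> carrier_vec D" "vnorm_sq (init (A i)) = 1"
    and Aops: "\<And>W. W \<in> set (ops (A i)) \<Longrightarrow> unitary_mat D W" "length (ops (A i)) = q"
    and Aacc: "acc (A i) \<in> carrier_mat D D" "acc (A i) * acc (A i) = acc (A i)" "adj (acc (A i)) = acc (A i)"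
    if "i < m" for i
    using A[OF that] by (auto simp: valid_qalg_def D_def num_queries_def)
  \<comment> \<open>\<open>v i\<close> stores \<open>e i\<close> as a vector: row index in the
    system, column index in the register, inner ancilla at 0. Since \<open>N \<le> m\<close>, the
    register has room for the columns.\<close>
  define v where "v = (\<lambda>i. block_vec D m (\<lambda>r. vec D (\<lambda>y. if y mod d = 0 \<and> r < N then e i (y div d) r else 0)))"
  define w where "w = (\<lambda>i. block_vec D m (\<lambda>j. if j = i then init (A i) else 0\<^sub>v D))"
  have vv: "vec_inner (D * m) (v i) (v j) = of_bool (i = j)" if ij: "i < m" "j < m" for i j
  proof -
    have "vec_inner D (vec D (\<lambda>y. if y mod d = 0 \<and> r < N then e i (y div d) r else 0))
        (vec D (\<lambda>y. if y mod d = 0 \<and> r < N then e j (y div d) r else 0))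
      = (if r < N then \<Sum>x<N. cnj (e i x r) * e j x r else 0)" for r
    proof -
      have "vec_inner D (vec D (\<lambda>y. if y mod d = 0 \<and> r < N then e i (y div d) r else 0))
          (vec D (\<lambda>y. if y mod d = 0 \<and> r < N then e j (y div d) r else 0))
        = (\<Sum>y<N * d. (\<lambda>x a. if a = 0 then (if r < N then cnj (e i x r) * e j x r else 0) else 0) (y div d) (y mod d))"
        unfolding inner_on_def D_def by (intro sum.cong refl) simp
      also have "\<dots> = (\<Sum>x<N. \<Sum>a<d. if a = 0 then (if r < N then cnj (e i x r) * e j x r else 0) else 0)"
        by (rule sum_div_mod) (use d in simp)
      finally show ?thesis
        using d by simp
    qed
    then have "vec_inner (D * m) (v i) (v j) = (\<Sum>r<m. if r < N then \<Sum>x<N. cnj (e i x r) * e j x r else 0)"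
      unfolding v_def vec_inner_block_vec[OF m] by simp
    also have "\<dots> = (\<Sum>r<N. \<Sum>x<N. cnj (e i x r) * e j x r)"
      using Nm by (intro sum.mono_neutral_cong_right) auto
    also have "\<dots> = of_bool (i = j)"
      using e[OF ij] by (subst sum.swap)
    finally show ?thesis .
  qed
  have ww: "vec_inner (D * m) (w i) (w j) = of_bool (i = j)" if ij: "i < m" "j < m" for i j
  proof -
    have "vec_inner (D * m) (w i) (w j) = (\<Sum>l<m. if l = i then of_bool (i = j) else 0)"
      unfolding w_def vec_inner_block_vec[OF m]
    proof (intro sum.cong refl)
      fix l
      show "vec_inner D (if l = i then init (A i) else 0\<^sub>v D) (if l = j then init (A j) else 0\<^sub>v D)
        = (if l = i then of_bool (i = j) else 0)"
        using Ainit[OF ij(1)] vec_inner_self[of "init (A i)" D] by (auto simp: inner_on_def)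
    qed
    then show ?thesis
      using ij by simp
  qed
  obtain W where W: "unitary_mat (D * m) W" and Wv: "\<And>i. i < m \<Longrightarrow> W *\<^sub>v v i = w i"
    using unitary_mapping_orthonormal[of m v "D * m" w] vv ww by (auto simp: v_def w_def)
  have WD: "W \<in> carrier_mat (D * m) (D * m)"
    using W by (simp add: unitary_mat_def)
  \<comment> \<open>The maximally entangled state between the system and the first \<open>N\<close>
    register values, with the inner ancilla at 0.\<close>
  define \<phi> where "\<phi> = (\<lambda>r. vec D (\<lambda>y. if y mod d = 0 \<and> y div d = r then complex_of_real (1 / sqrt (real N)) else 0))"
  have \<phi>: "\<phi> r \<in> carrier_vec D" for r
    by (simp add: \<phi>_def)
  \<comment> \<open>\<open>W\<close> follows the first query, which accounts for the extra query;
    all later operations are controlled by the register.\<close>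
  define B where "B = \<lparr>anc = d * m, init = block_vec D m \<phi>,
     ops = W # map (\<lambda>j. block_mat D m (\<lambda>i. ops (A i) ! j)) [0..<q],
     acc = block_mat D m (\<lambda>i. acc (A i))\<rparr>"
  have nth: "unitary_mat D (ops (A i) ! j)" if "i < m" "j < q" for i j
    using Aops[OF that(1)] that(2) by simp
  have "vnorm_sq (\<phi> r) = (if r < N then 1 / real N else 0)" for r
  proof -
    have "vnorm_sq (\<phi> r) = (\<Sum>y<N * d. (\<lambda>x a. if a = 0 then (if x = r then 1 / real N else 0) else 0) (y div d) (y mod d))"
      unfolding vnorm_sq_def \<phi>_def D_def dim_vec
      by (intro sum.cong refl) (simp add: norm_divide power_divide)
    also have "\<dots> = (\<Sum>x<N. \<Sum>a<d. if a = 0 then (if x = r then 1 / real N else 0) else 0)"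
      by (rule sum_div_mod) (use d in simp)
    finally show ?thesis
      using d by simp
  qed
  then have "vnorm_sq (block_vec D m \<phi>) = (\<Sum>r<m. if r < N then 1 / real N else 0)"
    using \<phi> m by (simp add: vnorm_sq_block_vec)
  also have "\<dots> = (\<Sum>r<N. 1 / real N)"
    using Nm by (intro sum.mono_neutral_cong_right) auto
  also have "\<dots> = 1"
    using N by simp
  finally have "vnorm_sq (block_vec D m \<phi>) = 1" .
  moreover have "block_mat D m (\<lambda>i. acc (A i)) * block_mat D m (\<lambda>i. acc (A i)) = block_mat D m (\<lambda>i. acc (A i))"
    using m Aacc by (simp add: block_mat_mult cong: block_mat_cong)
  moreover have "adj (block_mat D m (\<lambda>i. acc (A i))) = block_mat D m (\<lambda>i. acc (A i))"
    using Aacc by (simp add: adj_block_mat cong: block_mat_cong)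
  moreover have ND: "N * (d * m) = D * m"
    by (simp add: D_def)
  ultimately have "valid_qalg N B"
    unfolding valid_qalg_def B_def qalg.simps ND
    using d m W nth by (auto intro!: unitary_block_mat)
  moreover have "accept_prob B U = (\<Sum>i<m. (cmod (c i))\<^sup>2 * accept_prob (A i) U)"
    if U: "U \<in> carrier_mat N N"
      and c: "\<And>x y. x < N \<Longrightarrow> y < N \<Longrightarrow> U $$ (x,y) / sqrt (real N) = (\<Sum>i<m. c i * e i x y)" for U c
  proof -
    let ?K = "kron_id d U"
    let ?K' = "block_mat D m (\<lambda>_. ?K)"
    have K: "?K \<in> carrier_mat D D"
      unfolding D_def by (rule kron_id_carrier[OF U])
    have K': "kron_id (d * m) U = ?K'"
      unfolding D_def by (rule kron_id_block_mat[OF U])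
    define s where "s = ?K' *\<^sub>v block_vec D m \<phi>"
    have s_carrier: "s \<in> carrier_vec (D * m)"
      unfolding s_def by (rule mult_mat_vec_carrier[OF block_mat_carrier block_vec_carrier])
    \<comment> \<open>The query writes the entries of \<open>U\<close> over sqrt N into the state,
      so the coefficients \<open>c i\<close> become the amplitudes of the
      \<open>v i\<close>.\<close>
    have s: "s $ t = (\<Sum>i<m. c i * v i $ t)" if t: "t < D * m" for t
    proof -
      define y r where "y = t div m" and "r = t mod m"
      have yr: "y < D" "r < m"
        using block_index[OF t] by (simp_all add: y_def r_def)
      have y: "y div d < N" "y mod d < d"
        using block_index[of y N d] yr by (simp_all add: D_def)
      have "s $ t = (?K *\<^sub>v \<phi> r) $ y"
        using t K \<phi> m by (simp add: s_def block_mat_mult_vec) (simp add: block_vec_def y_def r_def)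
      also have "\<dots> = (\<Sum>z<N * d. (\<lambda>x a. if a = 0 then (if x = r then
          (if y mod d = 0 then U $$ (y div d, r) / sqrt (real N) else 0) else 0) else 0) (z div d) (z mod d))"
        unfolding mult_mat_vec_nth[OF K \<phi> yr(1)] unfolding D_def
        by (intro sum.cong refl) (use U yr in \<open>auto simp: kron_id_def \<phi>_def D_def\<close>)
      also have "\<dots> = (\<Sum>x<N. \<Sum>a<d. if a = 0 then (if x = r then
          (if y mod d = 0 then U $$ (y div d, r) / sqrt (real N) else 0) else 0) else 0)"
        by (rule sum_div_mod) (use d in simp)
      also have "\<dots> = (if y mod d = 0 \<and> r < N then U $$ (y div d, r) / sqrt (real N) else 0)"
        using d by simp
      also have "\<dots> = (\<Sum>i<m. c i * v i $ t)"
      proof -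
        have "v i $ t = (if y mod d = 0 \<and> r < N then e i (y div d) r else 0)" for i
          using t yr by (simp add: v_def block_vec_def flip: y_def r_def)
        then show ?thesis
          using c[OF y(1)] by simp
      qed
      finally show ?thesis .
    qed
    have Ws: "W *\<^sub>v s = block_vec D m (\<lambda>i. c i \<cdot>\<^sub>v init (A i))"
    proof (rule eq_vecI)
      fix t assume "t < dim_vec (block_vec D m (\<lambda>i. c i \<cdot>\<^sub>v init (A i)))"
      then have t: "t < D * m"
        by (simp add: block_vec_def)
      have "(W *\<^sub>v s) $ t = (\<Sum>l<D * m. \<Sum>i<m. c i * (W $$ (t,l) * v i $ l))"
        unfolding mult_mat_vec_nth[OF WD s_carrier t]
        by (intro sum.cong refl) (simp add: s sum_distrib_left mult.left_commute)
      also have "\<dots> = (\<Sum>i<m. c i * (\<Sum>l<D * m. W $$ (t,l) * v i $ l))"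
        by (subst sum.swap) (simp add: sum_distrib_left)
      also have "\<dots> = (\<Sum>i<m. c i * w i $ t)"
      proof (intro sum.cong refl)
        fix i assume "i \<in> {..<m}"
        then show "c i * (\<Sum>l<D * m. W $$ (t,l) * v i $ l) = c i * w i $ t"
          using mult_mat_vec_nth[OF WD _ t, of "v i"] Wv[of i] by (simp add: v_def)
      qed
      also have "\<dots> = (\<Sum>i<m. if t mod m = i then c i * init (A i) $ (t div m) else 0)"
        using t block_index[OF t] by (intro sum.cong refl) (simp add: w_def block_vec_def)
      also have "\<dots> = c (t mod m) * init (A (t mod m)) $ (t div m)"
        using m by simp
      also have "\<dots> = block_vec D m (\<lambda>i. c i \<cdot>\<^sub>v init (A i)) $ t"
        using t block_index[OF t] Ainit(1)[of "t mod m"] by (simp add: block_vec_def)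
      finally show "(W *\<^sub>v s) $ t = block_vec D m (\<lambda>i. c i \<cdot>\<^sub>v init (A i)) $ t" .
    qed (use WD in \<open>simp add: block_vec_def\<close>)
    have opsD: "X \<in> carrier_mat D D" if "i < m" "X \<in> set (ops (A i))" for i X
      using Aops(1)[OF that] by (simp add: unitary_mat_def)
    have "final_state B U = fold (\<lambda>W s. W *\<^sub>v (?K' *\<^sub>v s)) (map (\<lambda>j. block_mat D m (\<lambda>i. ops (A i) ! j)) [0..<q])
       (block_vec D m (\<lambda>i. c i \<cdot>\<^sub>v init (A i)))"
      unfolding final_state_def B_def by (simp add: K' Ws flip: s_def)
    also have "\<dots> = block_vec D m (\<lambda>i. fold (\<lambda>W s. W *\<^sub>v (?K *\<^sub>v s)) (ops (A i)) (c i \<cdot>\<^sub>v init (A i)))"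
      by (rule fold_query_block[OF m K opsD]) (use Aops Ainit in auto)
    also have "\<dots> = block_vec D m (\<lambda>i. c i \<cdot>\<^sub>v final_state (A i) U)"
    proof (rule block_vec_cong)
      fix i assume i: "i < m"
      show "fold (\<lambda>W s. W *\<^sub>v (?K *\<^sub>v s)) (ops (A i)) (c i \<cdot>\<^sub>v init (A i)) = c i \<cdot>\<^sub>v final_state (A i) U"
        using fold_query_smult[OF K opsD[OF i] Ainit(1)[OF i]] A[OF i] by (simp add: final_state_def)
    qed
    finally have fin: "final_state B U = block_vec D m (\<lambda>i. c i \<cdot>\<^sub>v final_state (A i) U)" .
    have fs: "final_state (A i) U \<in> carrier_vec D" if "i < m" for i
      using fold_query_carrier[OF K opsD[OF that] Ainit(1)[OF that]] A[OF that] by (simp add: final_state_def)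
    have "acc B *\<^sub>v final_state B U = block_vec D m (\<lambda>i. acc (A i) *\<^sub>v (c i \<cdot>\<^sub>v final_state (A i) U))"
      unfolding fin using m Aacc fs by (simp add: B_def block_mat_mult_vec)
    \<comment> \<open>The amplitude passes through each branch as a scalar. Branches are orthogonal,
      so the acceptance probabilities add with weights |c i|^2.\<close>
    also have "\<dots> = block_vec D m (\<lambda>i. c i \<cdot>\<^sub>v (acc (A i) *\<^sub>v final_state (A i) U))"
      using Aacc fs by (intro block_vec_cong) (simp add: mult_mat_vec[of _ D D])
    finally show ?thesis
      unfolding accept_prob_def using m Aacc fs
      by (simp add: vnorm_sq_block_vec vnorm_sq_smult mult_mat_vec_carrier[of _ D D])
  qed
  moreover have "anc B = d * m" "num_queries B = Suc q"
    by (simp_all add: B_def num_queries_def)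
  ultimately show ?thesis
    by (intro exI[of _ B] conjI allI impI) simp_all
qed

section \<open>The tester\<close>

text \<open>The matrix of X^a Z^b scaled to Hilbert-Schmidt norm 1.\<close>

definition pauli_entry :: "nat \<Rightarrow> nat set \<Rightarrow> nat set \<Rightarrow> nat set \<Rightarrow> nat set \<Rightarrow> complex" where
  "pauli_entry n a b X Y = (if X = sym_diff a Y then walsh b Y / sqrt (2 ^ n) else 0)"

lemma set_decode_subset: "x < 2 ^ n \<Longrightarrow> set_decode x \<subseteq> {..<n}"
  by (metis Pow_iff bij_betw_imp_surj_on bij_betw_set_encode finite_lessThan finite_subset imageE
      lessThan_iff set_encode_inverse)

lemma sum_set_decode: "(\<Sum>x<2 ^ n. f (set_decode x)) = (\<Sum>X\<in>Pow {..<n}. f X)"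
  unfolding sum_set_encode by (intro sum.cong refl) (metis PowD finite_lessThan finite_subset set_encode_inverse)

lemma sum_pauli_index:
  "(\<Sum>i<2 ^ n * 2 ^ n. f (set_decode (i div 2 ^ n)) (set_decode (i mod 2 ^ n)))
   = (\<Sum>a\<in>Pow {..<n}. \<Sum>b\<in>Pow {..<n}. f a b)"
proof -
  have "(\<Sum>i<2 ^ n * 2 ^ n. f (set_decode (i div 2 ^ n)) (set_decode (i mod 2 ^ n)))
     = (\<Sum>x<2 ^ n. \<Sum>y<2 ^ n. f (set_decode x) (set_decode y))"
    by (rule sum_div_mod) simp
  also have "\<dots> = (\<Sum>x<2 ^ n. \<Sum>b\<in>Pow {..<n}. f (set_decode x) b)"
    by (intro sum.cong refl sum_set_decode)
  also have "\<dots> = (\<Sum>a\<in>Pow {..<n}. \<Sum>b\<in>Pow {..<n}. f a b)"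
    by (rule sum_set_decode)
  finally show ?thesis .
qed

lemma sym_diff_eq_iff: "X = sym_diff a Y \<longleftrightarrow> a = sym_diff X Y"
  by blast

text \<open>Different flips have disjoint supports. For equal flips a Walsh sum over
  \<open>Y\<close> remains, and \<open>walsh_commute\<close> brings \<open>Y\<close> into the
  argument over which \<open>walsh_orthogonal\<close> sums.\<close>

lemma pauli_entry_orthonormal:
  assumes "a \<subseteq> {..<n}" "b \<subseteq> {..<n}" "a' \<subseteq> {..<n}" "b' \<subseteq> {..<n}"
  shows "(\<Sum>X\<in>Pow {..<n}. \<Sum>Y\<in>Pow {..<n}. cnj (pauli_entry n a b X Y) * pauli_entry n a' b' X Y)
    = of_bool (a = a' \<and> b = b')"
proof -
  let ?S = "Pow {..<n}"
  have fin: "finite Y" if "Y \<subseteq> {..<n}" for Y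
    using that finite_subset by blast
  have "(\<Sum>X\<in>?S. \<Sum>Y\<in>?S. cnj (pauli_entry n a b X Y) * pauli_entry n a' b' X Y)
    = (\<Sum>Y\<in>?S. \<Sum>X\<in>?S. cnj (pauli_entry n a b X Y) * pauli_entry n a' b' X Y)"
    by (rule sum.swap)
  also have "\<dots> = (\<Sum>Y\<in>?S. \<Sum>X\<in>?S. if X = sym_diff a Y then of_bool (a = a') * (walsh Y b * walsh Y b' / 2 ^ n) else 0)"
  proof (intro sum.cong refl)
    fix X Y assume XY: "X \<in> ?S" "Y \<in> ?S"
    have w: "walsh b Y = walsh Y b" "walsh b' Y = walsh Y b'"
      using XY assms by (auto intro!: walsh_commute fin)
    have sq: "complex_of_real (sqrt (2 ^ n)) * complex_of_real (sqrt (2 ^ n)) = 2 ^ n"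
      by (simp flip: of_real_mult)
    have "sym_diff a Y = sym_diff a' Y \<longleftrightarrow> a = a'"
      by blast
    then show "cnj (pauli_entry n a b X Y) * pauli_entry n a' b' X Y
      = (if X = sym_diff a Y then of_bool (a = a') * (walsh Y b * walsh Y b' / 2 ^ n) else 0)"
      unfolding pauli_entry_def w by (simp add: sq)
  qed
  also have "\<dots> = (\<Sum>Y\<in>?S. of_bool (a = a') * (walsh Y b * walsh Y b' / 2 ^ n))"
  proof (intro sum.cong refl)
    fix Y assume "Y \<in> ?S"
    then have "sym_diff a Y \<in> ?S"
      using assms by blast
    then show "(\<Sum>X\<in>?S. if X = sym_diff a Y then of_bool (a = a') * (walsh Y b * walsh Y b' / 2 ^ n) else 0)
      = of_bool (a = a') * (walsh Y b * walsh Y b' / 2 ^ n)"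
      by (subst sum.delta) auto
  qed
  also have "\<dots> = of_bool (a = a') * ((\<Sum>Y\<in>?S. walsh Y b * walsh Y b') / 2 ^ n)"
    by (simp add: sum_distrib_left sum_divide_distrib)
  also have "\<dots> = of_bool (a = a' \<and> b = b')"
    using assms by (simp add: walsh_orthogonal)
  finally show ?thesis .
qed

lemma pauli_entry_expansion:
  assumes "X \<subseteq> {..<n}" "Y \<subseteq> {..<n}"
  shows "(\<Sum>a\<in>Pow {..<n}. \<Sum>b\<in>Pow {..<n}. pauli_coeff n u a b * pauli_entry n a b X Y) = u X Y / sqrt (2 ^ n)"
proof -
  let ?S = "Pow {..<n}"
  have "(\<Sum>a\<in>?S. \<Sum>b\<in>?S. pauli_coeff n u a b * pauli_entry n a b X Y)
    = (\<Sum>a\<in>?S. if a = sym_diff X Y then (\<Sum>b\<in>?S. pauli_coeff n u a b * walsh b Y) / sqrt (2 ^ n) else 0)"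
    unfolding pauli_entry_def sym_diff_eq_iff[of X] by (intro sum.cong refl) (simp add: sum_divide_distrib)
  also have "\<dots> = (\<Sum>b\<in>?S. pauli_coeff n u (sym_diff X Y) b * walsh b Y) / sqrt (2 ^ n)"
    by (subst sum.delta) (use assms in auto)
  finally show ?thesis
    unfolding pauli_expansion[OF assms] .
qed

text \<open>The probability that \<open>q\<close> sampled Pauli operators, together with \<open>T\<close>, involve at most \<open>k\<close>
  qubits; \<open>X\<^sup>aZ\<^sup>b\<close> acts nontrivially on exactly the qubits in \<open>a \<union> b\<close>.\<close>

primrec stay_prob :: "nat \<Rightarrow> nat \<Rightarrow> (nat set \<Rightarrow> nat set \<Rightarrow> complex) \<Rightarrow> nat \<Rightarrow> nat set \<Rightarrow> real" where
  "stay_prob n k u 0 T = of_bool (card T \<le> k)"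
| "stay_prob n k u (Suc q) T = (\<Sum>a\<in>Pow {..<n}. \<Sum>b\<in>Pow {..<n}.
     (cmod (pauli_coeff n u a b))\<^sup>2 * stay_prob n k u q (T \<union> a \<union> b))"

lemma trivial_qalg:
  assumes "N \<ge> 1"
  shows "\<exists>A. valid_qalg N A \<and> anc A = 1 \<and> num_queries A = 0 \<and> (\<forall>U. accept_prob A U = of_bool P)"
proof -
  define A where "A = \<lparr>anc = 1, init = unit_vec N 0, ops = [], acc = (if P then 1\<^sub>m N else 0\<^sub>m N N)\<rparr>"
  have norm: "vnorm_sq (unit_vec N 0) = 1"
  proof -
    have "vnorm_sq (unit_vec N 0) = (\<Sum>i<N. if i = 0 then 1 else 0)"
      unfolding vnorm_sq_def by (intro sum.cong) auto
    then show ?thesis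
      using assms by simp
  qed
  have "adj (1\<^sub>m N) = 1\<^sub>m N" "adj (0\<^sub>m N N) = 0\<^sub>m N N"
    by (auto simp: adj_def)
  then have "valid_qalg N A"
    using norm by (simp add: A_def valid_qalg_def)
  moreover have "accept_prob A U = of_bool P" for U
    using norm by (simp add: A_def accept_prob_def final_state_def) (simp add: vnorm_sq_def)
  ultimately show ?thesis
    by (intro exI[of _ A]) (simp add: A_def num_queries_def)
qed

text \<open>Induction on \<open>q\<close>: outcome (a, b) branches to the algorithm for
  \<open>T \<union> a \<union> b\<close>, so the seen qubits are hard-wired into the branch. The
  ancilla dimension is chosen before \<open>T\<close> because all branches must share it.\<close>

lemma pauli_sampling_qalg:
  "\<exists>d\<ge>1. \<forall>T. \<exists>A. valid_qalg (2 ^ n) A \<and> anc A = d \<and> num_queries A = q \<and>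
     (\<forall>U\<in>carrier_mat (2 ^ n) (2 ^ n). accept_prob A U = stay_prob n k (set_entry U) q T)"
proof (induction q)
  case 0
  show ?case
  proof (intro exI[of _ 1] conjI allI)
    fix T :: "nat set"
    obtain A where "valid_qalg (2 ^ n) A" "anc A = 1" "num_queries A = 0" "\<And>U. accept_prob A U = of_bool (card T \<le> k)"
      using trivial_qalg[of "2 ^ n" "card T \<le> k"] by auto
    then show "\<exists>A. valid_qalg (2 ^ n) A \<and> anc A = 1 \<and> num_queries A = 0 \<and>
     (\<forall>U\<in>carrier_mat (2 ^ n) (2 ^ n). accept_prob A U = stay_prob n k (set_entry U) 0 T)"
      by (intro exI[of _ A]) simp
  qed simp
next
  case (Suc q)
  let ?N = "2 ^ n :: nat"
  obtain d AA where d: "d \<ge> 1" and AA: "\<And>T. valid_qalg ?N (AA T) \<and> anc (AA T) = d \<and> num_queries (AA T) = q \<and>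
     (\<forall>U\<in>carrier_mat ?N ?N. accept_prob (AA T) U = stay_prob n k (set_entry U) q T)"
    using Suc.IH by metis
  \<comment> \<open>An outcome number encodes the pair (a, b) by quotient and remainder.\<close>
  let ?a = "\<lambda>i. set_decode (i div ?N)" and ?b = "\<lambda>i. set_decode (i mod ?N)"
  let ?e = "\<lambda>i x y. pauli_entry n (?a i) (?b i) (set_decode x) (set_decode y)"
  have sub: "?a i \<subseteq> {..<n}" "?b i \<subseteq> {..<n}" if "i < ?N * ?N" for i
    using block_index[OF that] by (auto intro!: set_decode_subset simp del: subset_iff)
  have orth: "(\<Sum>x<?N. \<Sum>y<?N. cnj (?e i x y) * ?e j x y) = of_bool (i = j)" if "i < ?N * ?N" "j < ?N * ?N" for i j
  proof -
    have "(\<Sum>x<?N. \<Sum>y<?N. cnj (?e i x y) * ?e j x y)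
      = (\<Sum>x<?N. \<Sum>Y\<in>Pow {..<n}. cnj (pauli_entry n (?a i) (?b i) (set_decode x) Y) * pauli_entry n (?a j) (?b j) (set_decode x) Y)"
      by (intro sum.cong refl sum_set_decode)
    also have "\<dots> = (\<Sum>X\<in>Pow {..<n}. \<Sum>Y\<in>Pow {..<n}. cnj (pauli_entry n (?a i) (?b i) X Y) * pauli_entry n (?a j) (?b j) X Y)"
      by (rule sum_set_decode)
    also have "\<dots> = of_bool (?a i = ?a j \<and> ?b i = ?b j)"
      by (rule pauli_entry_orthonormal) (use sub that in auto)
    also have "?a i = ?a j \<and> ?b i = ?b j \<longleftrightarrow> i = j"
      by (metis div_mult_mod_eq set_decode_inverse)
    finally show ?thesis .
  qed
  show ?case
  proof (intro exI[of _ "d * (?N * ?N)"] conjI allI)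
    show "1 \<le> d * (?N * ?N)"
      using d by simp
    fix T
    have "\<exists>B. valid_qalg ?N B \<and> anc B = d * (?N * ?N) \<and> num_queries B = Suc q \<and>
      (\<forall>U c. U \<in> carrier_mat ?N ?N \<longrightarrow>
       (\<forall>x<?N. \<forall>y<?N. U $$ (x,y) / sqrt (real ?N) = (\<Sum>i<?N * ?N. c i * ?e i x y)) \<longrightarrow>
       accept_prob B U = (\<Sum>i<?N * ?N. (cmod (c i))\<^sup>2 * accept_prob (AA (T \<union> ?a i \<union> ?b i)) U))"
      by (rule sequential_composition[OF _ d _ orth]) (use AA in auto)
    then obtain B where B: "valid_qalg ?N B" "anc B = d * (?N * ?N)" "num_queries B = Suc q"
      and acc: "\<And>U c. U \<in> carrier_mat ?N ?N \<Longrightarrow>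
       (\<And>x y. x < ?N \<Longrightarrow> y < ?N \<Longrightarrow> U $$ (x,y) / sqrt (real ?N) = (\<Sum>i<?N * ?N. c i * ?e i x y)) \<Longrightarrow>
       accept_prob B U = (\<Sum>i<?N * ?N. (cmod (c i))\<^sup>2 * accept_prob (AA (T \<union> ?a i \<union> ?b i)) U)"
      by auto
    have "accept_prob B U = stay_prob n k (set_entry U) (Suc q) T" if U: "U \<in> carrier_mat ?N ?N" for U
    proof -
      let ?c = "\<lambda>a b. pauli_coeff n (set_entry U) a b"
      have "accept_prob B U = (\<Sum>i<?N * ?N. (cmod (?c (?a i) (?b i)))\<^sup>2 * accept_prob (AA (T \<union> ?a i \<union> ?b i)) U)"
      proof (rule acc[OF U])
        fix x y assume xy: "x < ?N" "y < ?N"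
        have "(\<Sum>i<?N * ?N. ?c (?a i) (?b i) * ?e i x y)
          = (\<Sum>a\<in>Pow {..<n}. \<Sum>b\<in>Pow {..<n}. ?c a b * pauli_entry n a b (set_decode x) (set_decode y))"
          by (rule sum_pauli_index)
        also have "\<dots> = set_entry U (set_decode x) (set_decode y) / sqrt (2 ^ n)"
          by (rule pauli_entry_expansion) (use xy set_decode_subset in blast)+
        finally show "U $$ (x,y) / sqrt (real ?N) = (\<Sum>i<?N * ?N. ?c (?a i) (?b i) * ?e i x y)"
          by (simp add: set_entry_def)
      qed
      also have "\<dots> = (\<Sum>a\<in>Pow {..<n}. \<Sum>b\<in>Pow {..<n}. (cmod (?c a b))\<^sup>2 * accept_prob (AA (T \<union> a \<union> b)) U)"
        by (rule sum_pauli_index)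
      finally show ?thesis
        using AA U by simp
    qed
    with B show "\<exists>A. valid_qalg ?N A \<and> anc A = d * (?N * ?N) \<and> num_queries A = Suc q \<and>
     (\<forall>U\<in>carrier_mat ?N ?N. accept_prob A U = stay_prob n k (set_entry U) (Suc q) T)"
      by blast
  qed
qed

section \<open>Completeness and soundness of the sampler\<close>

lemma stay_prob_nonneg: "0 \<le> stay_prob n k u q T"
  by (induction q arbitrary: T) (auto intro!: sum_nonneg mult_nonneg_nonneg)

text \<open>All sampling weight lies inside \<open>T\<close>, so the seen qubits stay there.
  Restricting the sums to subsets of \<open>T\<close> drops only nonnegative terms.\<close>

lemma stay_prob_ge_1:
  assumes T: "T \<subseteq> {..<n}" "card T \<le> k"
    and total: "(\<Sum>a\<in>Pow T. \<Sum>b\<in>Pow T. (cmod (pauli_coeff n u a b))\<^sup>2) = 1"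
    and R: "R \<subseteq> T"
  shows "1 \<le> stay_prob n k u q R"
  using R
proof (induction q arbitrary: R)
  case 0
  have "card R \<le> card T"
    using T 0 by (meson card_mono finite_lessThan finite_subset)
  then show ?case
    using T by simp
next
  case (Suc q)
  let ?p = "\<lambda>a b. (cmod (pauli_coeff n u a b))\<^sup>2"
  have "1 = (\<Sum>a\<in>Pow T. \<Sum>b\<in>Pow T. ?p a b * 1)"
    using total by simp
  also have "\<dots> \<le> (\<Sum>a\<in>Pow T. \<Sum>b\<in>Pow T. ?p a b * stay_prob n k u q (R \<union> a \<union> b))"
    using Suc by (intro sum_mono mult_left_mono) auto
  also have "\<dots> \<le> (\<Sum>a\<in>Pow T. \<Sum>b\<in>Pow {..<n}. ?p a b * stay_prob n k u q (R \<union> a \<union> b))"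
    using T by (intro sum_mono sum_mono2) (auto simp: stay_prob_nonneg)
  also have "\<dots> \<le> stay_prob n k u (Suc q) R"
    unfolding stay_prob.simps
    using T by (intro sum_mono2) (auto simp: stay_prob_nonneg intro!: sum_nonneg)
  finally show ?case .
qed

text \<open>The potential halves whenever a sample meets a new qubit, which happens with probability
  at least \<open>\<delta>\<close> as long as at most \<open>k\<close> qubits have been seen.\<close>

lemma stay_prob_decay:
  assumes total: "(\<Sum>a\<in>Pow {..<n}. \<Sum>b\<in>Pow {..<n}. (cmod (pauli_coeff n u a b))\<^sup>2) = 1"
    and small: "\<And>T. T \<subseteq> {..<n} \<Longrightarrow> card T \<le> k \<Longrightarrow>
      (\<Sum>a\<in>Pow T. \<Sum>b\<in>Pow T. (cmod (pauli_coeff n u a b))\<^sup>2) \<le> 1 - \<delta>"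
    and \<delta>: "\<delta> \<le> 1" and T: "T \<subseteq> {..<n}"
  shows "stay_prob n k u q T \<le> (1 - \<delta> / 2) ^ q * (if card T \<le> k then 2 ^ (k - card T) else 0)"
  using T
proof (induction q arbitrary: T)
  case 0
  then show ?case
    by simp
next
  case (Suc q)
  let ?S = "Pow {..<n}" and ?p = "\<lambda>a b. (cmod (pauli_coeff n u a b))\<^sup>2" and ?r = "(1 - \<delta> / 2) ^ q"
  \<comment> \<open>The potential is 0 beyond \<open>k\<close>, where acceptance has become
    impossible, and at least 1 otherwise.\<close>
  let ?g = "\<lambda>T. if card T \<le> k then 2 ^ (k - card T) else (0::real)"
  have r: "0 \<le> ?r"
    using \<delta> by simp
  \<comment> \<open>A new qubit raises the cardinality and at least halves the potential; the last
    factor is 2 without a new qubit and 1 with one.\<close>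
  have pot: "?g (T \<union> a \<union> b) \<le> ?g T / 2 * (1 + of_bool (a \<subseteq> T \<and> b \<subseteq> T))" if "a \<in> ?S" "b \<in> ?S" for a b
  proof (cases "a \<subseteq> T \<and> b \<subseteq> T")
    case True
    then have "T \<union> a \<union> b = T"
      by blast
    then show ?thesis
      using True by simp
  next
    case False
    then have "T \<subset> T \<union> a \<union> b"
      by blast
    moreover have "finite (T \<union> a \<union> b)"
      using Suc.prems that finite_subset[of _ "{..<n}"] by auto
    ultimately have less: "card T < card (T \<union> a \<union> b)"
      by (rule psubset_card_mono[rotated])
    then have "(2::real) * 2 ^ (k - card (T \<union> a \<union> b)) \<le> 2 ^ (k - card T)" if "card (T \<union> a \<union> b) \<le> k"
      unfolding power_Suc[symmetric] using that by (intro power_increasing) auto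
    then show ?thesis
      using False less by auto
  qed
  have "stay_prob n k u (Suc q) T \<le> (\<Sum>a\<in>?S. \<Sum>b\<in>?S. ?p a b * (?r * (?g T / 2 * (1 + of_bool (a \<subseteq> T \<and> b \<subseteq> T)))))"
    unfolding stay_prob.simps
  proof (intro sum_mono mult_left_mono)
    fix a b assume ab: "a \<in> ?S" "b \<in> ?S"
    have "stay_prob n k u q (T \<union> a \<union> b) \<le> ?r * ?g (T \<union> a \<union> b)"
      using ab Suc.prems by (intro Suc.IH) auto
    also have "\<dots> \<le> ?r * (?g T / 2 * (1 + of_bool (a \<subseteq> T \<and> b \<subseteq> T)))"
      by (rule mult_left_mono[OF pot[OF ab] r])
    finally show "stay_prob n k u q (T \<union> a \<union> b) \<le> ?r * (?g T / 2 * (1 + of_bool (a \<subseteq> T \<and> b \<subseteq> T)))" .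
  qed simp
  also have "\<dots> = ?r * ?g T / 2 * ((\<Sum>a\<in>?S. \<Sum>b\<in>?S. ?p a b) + (\<Sum>a\<in>?S. \<Sum>b\<in>?S. ?p a b * of_bool (a \<subseteq> T \<and> b \<subseteq> T)))"
    unfolding sum.distrib[symmetric] sum_distrib_left by (intro sum.cong refl) (simp add: algebra_simps)
  also have "(\<Sum>a\<in>?S. \<Sum>b\<in>?S. ?p a b * of_bool (a \<subseteq> T \<and> b \<subseteq> T)) = (\<Sum>a\<in>Pow T. \<Sum>b\<in>Pow T. ?p a b)"
  proof -
    have "(\<Sum>b\<in>?S. ?p a b * of_bool (a \<subseteq> T \<and> b \<subseteq> T)) = of_bool (a \<subseteq> T) * (\<Sum>b\<in>Pow T. ?p a b)" for a
      unfolding sum_distrib_left using Suc.prems by (intro sum.mono_neutral_cong_right) auto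
    moreover have "(\<Sum>a\<in>?S. of_bool (a \<subseteq> T) * (\<Sum>b\<in>Pow T. ?p a b)) = (\<Sum>a\<in>Pow T. \<Sum>b\<in>Pow T. ?p a b)"
      using Suc.prems by (intro sum.mono_neutral_cong_right) auto
    ultimately show ?thesis
      by simp
  qed
  \<comment> \<open>Outcomes inside \<open>T\<close> weigh at most 1 - \<delta>, so one sample
    multiplies the potential on average by at most (1 + (1 - \<delta>))/2.\<close>
  also have "?r * ?g T / 2 * ((\<Sum>a\<in>?S. \<Sum>b\<in>?S. ?p a b) + (\<Sum>a\<in>Pow T. \<Sum>b\<in>Pow T. ?p a b)) \<le> ?r * ?g T / 2 * (1 + (1 - \<delta>))"
  proof (cases "card T \<le> k")
    case True
    then show ?thesis
      using small[OF Suc.prems] total r by (intro mult_left_mono) auto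
  qed simp
  also have "\<dots> = (1 - \<delta> / 2) ^ Suc q * ?g T"
    by (simp add: field_simps)
  finally show ?case .
qed

text \<open>The weight is monotone in the set, and \<open>k \<le> n\<close> leaves room to enlarge
  \<open>T\<close> to exactly \<open>k\<close> qubits.\<close>

lemma pauli_weight_le_of_eps_far_card_le:
  assumes U: "unitary_mat (2 ^ n) U" and far: "eps_far (2 ^ n) (juntas n k) \<epsilon> U" and \<epsilon>: "\<epsilon> > 0"
    and T: "T \<subseteq> {..<n}" "card T \<le> k" and k: "k \<le> n"
  shows "(\<Sum>a\<in>Pow T. \<Sum>b\<in>Pow T. (cmod (pauli_coeff n (set_entry U) a b))\<^sup>2) \<le> 1 - \<epsilon>\<^sup>2"
proof -
  obtain R where R: "T \<subseteq> R" "R \<subseteq> {..<n}" "card R = k"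
    using exists_subset_between[OF T(2) _ T(1)] k by auto
  have "finite R"
    using R finite_subset by blast
  then have "(\<Sum>a\<in>Pow T. \<Sum>b\<in>Pow T. (cmod (pauli_coeff n (set_entry U) a b))\<^sup>2)
    \<le> (\<Sum>a\<in>Pow T. \<Sum>b\<in>Pow R. (cmod (pauli_coeff n (set_entry U) a b))\<^sup>2)"
    using R by (intro sum_mono sum_mono2) auto
  also have "\<dots> \<le> (\<Sum>a\<in>Pow R. \<Sum>b\<in>Pow R. (cmod (pauli_coeff n (set_entry U) a b))\<^sup>2)"
    using R \<open>finite R\<close> by (intro sum_mono2) (auto intro!: sum_nonneg)
  also have "\<dots> \<le> 1 - \<epsilon>\<^sup>2"
    by (rule pauli_weight_le_of_eps_far[OF U far \<epsilon> R(2,3)])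
  finally show ?thesis .
qed

text \<open>Unitaries are at distance at most 1, and the identity provides a junta.\<close>

lemma not_eps_far_of_gt_1:
  assumes U: "unitary_mat (2 ^ n) U" and "k \<le> n" "\<epsilon> > 1"
  shows "\<not> eps_far (2 ^ n) (juntas n k) \<epsilon> U"
proof
  assume far: "eps_far (2 ^ n) (juntas n k) \<epsilon> U"
  let ?J = "embed_op n {..<k} (1\<^sub>m (2 ^ k))"
  have "?J \<in> juntas n k"
    unfolding juntas_def using \<open>k \<le> n\<close> unitary_mat_one by (auto intro!: exI[of _ "{..<k}"])
  then have "\<epsilon> \<le> dist_ph (2 ^ n) U ?J"
    using far by (simp add: eps_far_def)
  moreover have "unitary_mat (2 ^ n) ?J"
    using \<open>k \<le> n\<close> by (intro unitary_embed_op) (auto simp: unitary_mat_one)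
  then have "dist_ph (2 ^ n) U ?J \<le> 1"
    by (intro dist_ph_le_1[OF U]) auto
  ultimately show False
    using \<open>\<epsilon> > 1\<close> by simp
qed

text \<open>By 1 - x \<le> e^(-x), and since the constant 6 gives q \<delta>/2 \<ge> 3k, the left
  side is at most (2/e^3)^k. Then e \<ge> 2 gives 2/e^3 \<le> 1/4.\<close>

lemma decay_le_third:
  fixes \<delta> :: real
  assumes "k \<ge> 1" "0 < \<delta>" "\<delta> \<le> 1" "real q \<ge> 6 * real k / \<delta>"
  shows "(1 - \<delta> / 2) ^ q * 2 ^ k \<le> 1 / 3"
proof -
  have "(1 - \<delta> / 2) ^ q \<le> exp (- \<delta> / 2) ^ q"
    using assms exp_ge_add_one_self[of "- \<delta> / 2"] by (intro power_mono) auto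
  also have "\<dots> = exp (- (real q * \<delta> / 2))"
    by (simp flip: exp_of_nat_mult)
  also have "\<dots> \<le> exp (- (3 * real k))"
    using assms by (simp add: field_simps)
  also have "\<dots> = (1 / exp 3) ^ k"
    by (simp add: exp_minus exp_of_nat2_mult power_one_over field_simps flip: exp_of_nat_mult)
  finally have "(1 - \<delta> / 2) ^ q * 2 ^ k \<le> (1 / exp 3) ^ k * 2 ^ k"
    by (rule mult_right_mono) simp
  also have "\<dots> = (2 / exp 3) ^ k"
    by (simp add: power_divide)
  also have "\<dots> \<le> (1 / 3) ^ k"
  proof (intro power_mono)
    have "(2::real) ^ 3 \<le> exp 1 ^ 3"
      using exp_ge_add_one_self[of 1] by (intro power_mono) auto
    also have "exp 1 ^ 3 = exp (3::real)"
      by (simp flip: exp_of_nat_mult)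
    finally show "2 / exp 3 \<le> (1 / 3 :: real)"
      by (simp add: divide_simps)
  qed simp
  also have "\<dots> \<le> (1 / 3) ^ 1"
    using assms by (intro power_decreasing) auto
  finally show ?thesis
    by simp
qed

theorem theorem2:
  shows "\<exists>C::real. \<forall>n k::nat. \<forall>\<epsilon>::real.
           1 \<le> n \<longrightarrow> 1 \<le> k \<longrightarrow> k \<le> n \<longrightarrow> \<epsilon> > 0 \<longrightarrow>
           (\<exists>A. valid_qalg (2^n) A \<and> eps_tests (2^n) A (juntas n k) \<epsilon> \<and>
                real (num_queries A) \<le> C * real k * max 1 (ln (real k / \<epsilon>)) / \<epsilon>\<^sup>2)"
proof (intro exI[of _ 7] allI impI)
  fix n k :: nat and \<epsilon> :: real
  assume k: "1 \<le> k" "k \<le> n" and \<epsilon>: "\<epsilon> > 0"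
  \<comment> \<open>The 6 is what \<open>decay_le_third\<close> asks for. For \<epsilon> > 1 no
    unitary is far, and zero samples mean that everything is accepted.\<close>
  define q where "q = (if \<epsilon> \<le> 1 then nat \<lceil>6 * real k / \<epsilon>\<^sup>2\<rceil> else 0)"
  obtain A where A: "valid_qalg (2 ^ n) A" "num_queries A = q"
    and acc: "\<And>U. U \<in> carrier_mat (2 ^ n) (2 ^ n) \<Longrightarrow> accept_prob A U = stay_prob n k (set_entry U) q {}"
    using pauli_sampling_qalg[of n q k] by blast
  have bound: "real q \<le> 7 * real k * max 1 (ln (real k / \<epsilon>)) / \<epsilon>\<^sup>2"
  proof (cases "\<epsilon> \<le> 1")
    case True
    \<comment> \<open>Rounding up costs at most 1 \<le> k/\<epsilon>^2, which turns the 6 into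
      7.\<close>
    have "\<epsilon>\<^sup>2 \<le> 1 * real k"
      using True \<epsilon> k power_le_one[of \<epsilon> 2] by simp
    then have "1 \<le> real k / \<epsilon>\<^sup>2"
      using \<epsilon> by (simp add: le_divide_eq)
    moreover have "real q \<le> 6 * real k / \<epsilon>\<^sup>2 + 1"
      unfolding q_def using True \<epsilon> k by simp
    ultimately have "real q \<le> 7 * real k / \<epsilon>\<^sup>2"
      by simp
    also have "\<dots> \<le> 7 * real k * max 1 (ln (real k / \<epsilon>)) / \<epsilon>\<^sup>2"
      using mult_left_mono[of 1 "max 1 (ln (real k / \<epsilon>))" "7 * real k"] by (intro divide_right_mono) auto
    finally show ?thesis .
  qed (simp add: q_def)
  have "eps_tests (2 ^ n) A (juntas n k) \<epsilon>"
    unfolding eps_tests_def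
  proof (intro allI impI conjI)
    fix U assume U: "unitary_mat (2 ^ n) U"
    then have prob: "accept_prob A U = stay_prob n k (set_entry U) q {}"
      by (simp add: acc unitary_mat_def)
    {
      assume "has_property (juntas n k) U"
      then obtain T where "T \<subseteq> {..<n}" "card T = k"
        "(\<Sum>a\<in>Pow T. \<Sum>b\<in>Pow T. (cmod (pauli_coeff n (set_entry U) a b))\<^sup>2) = 1"
        using has_property_pauli_weight by blast
      then have "1 \<le> accept_prob A U"
        unfolding prob by (intro stay_prob_ge_1) auto
      then show "2 / 3 \<le> accept_prob A U"
        by simp
    }
    assume far: "eps_far (2 ^ n) (juntas n k) \<epsilon> U"
    then have \<epsilon>1: "\<epsilon> \<le> 1"
      using not_eps_far_of_gt_1[OF U k(2), of \<epsilon>] by (meson not_le)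
    then have "\<epsilon>\<^sup>2 \<le> 1"
      using \<epsilon> by (simp add: power_le_one)
    \<comment> \<open>Sampling starts with no qubit seen, where the potential is 2^k.\<close>
    have "accept_prob A U \<le> (1 - \<epsilon>\<^sup>2 / 2) ^ q * 2 ^ k"
      using stay_prob_decay[where T="{}" and q=q, OF pauli_weight_total[OF U]
          pauli_weight_le_of_eps_far_card_le[OF U far \<epsilon> _ _ k(2)] \<open>\<epsilon>\<^sup>2 \<le> 1\<close>]
      by (simp add: prob)
    also have "\<dots> \<le> 1 / 3"
    proof (rule decay_le_third[OF k(1) _ \<open>\<epsilon>\<^sup>2 \<le> 1\<close>])
      show "6 * real k / \<epsilon>\<^sup>2 \<le> real q"
        unfolding q_def using \<epsilon>1 by simp
    qed (use \<epsilon> in simp)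
    finally show "accept_prob A U \<le> 1 / 3" .
  qed
  with A bound show "\<exists>A. valid_qalg (2^n) A \<and> eps_tests (2^n) A (juntas n k) \<epsilon> \<and>
                real (num_queries A) \<le> 7 * real k * max 1 (ln (real k / \<epsilon>)) / \<epsilon>\<^sup>2"
    by blast
qed

end
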